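(* Let $T$ be a Prüfer domain with the following properties: (1) $T$ is one-dimensional with $\mathrm{Max}(T) = \{M\} \cup \mathcal P$, with $\mathcal P$ infinite; (2) each element of $M$ is in $P$ for almost all $P \in \mathcal P$ (equivalently, each finitely generated ideal contained in $M$ is contained in $P$ for almost all $P \in \mathcal P$); (3) each element $a \in T \setminus M$ satisfies $a \notin P$ for infinitely many $P \in \mathcal P$; and (4) $T/M$ admits a proper subfield $F$ such that there are no fields properly between $F$ and $T/M$. Let $\varphi : T \to T/M$ be the canonical homomorphism and let $R = \varphi^{-1}(F)$. Then $R$ is an sQQR-domain but is not a QQR-domain. Moreover, $R_M$ is not an sQQR-domain.
   Context: For an integral domain $D$ with quotient field $K$, an overring of $D$ is a ring between $D$ and $K$; it is an intersection of localizations of $D$ if it equals $\bigcap_{P \in \mathcal S} D_P$ for some set $\mathcal S$ of prime ideals of $D$. $D$ is an sQQR-domain if each simple overring $D[u]$ ($u \in K$) is an intersection of localizations of $D$, and a QQR-domain if each overring of $D$ is an intersection of localizations of $D$. $\mathrm{Max}(T)$ is the set of maximal ideals of $T$; "almost all" means all but finitely many. Note that $M$ is a maximal ideal of $R=\varphi^{-1}(F)$ with $R/M = F$, and $R_M$ denotes the localization of $R$ at this ideal. *)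

theory Defs
  imports "HOL-Algebra.Algebra"
begin

text \<open>
  An integral domain is represented by its carrier \<open>D\<close>, a subring of a field \<open>K\<close> that is its
  quotient field; the ring itself is \<open>K\<lparr>carrier := D\<rparr>\<close>. Every integral domain arises in this
  way up to isomorphism, and overrings and localizations of \<open>D\<close> are then literally subsets of
  the carrier of \<open>K\<close>.
\<close>

definition has_quotient_field :: "('a, 'b) ring_scheme \<Rightarrow> 'a set \<Rightarrow> bool" where
  "has_quotient_field K D \<longleftrightarrow>
     field K \<and> subring D K \<and>
     (\<forall>x \<in> carrier K. \<exists>a \<in> D. \<exists>b \<in> D - {\<zero>\<^bsub>K\<^esub>}. x = a \<otimes>\<^bsub>K\<^esub> inv\<^bsub>K\<^esub> b)"

definition prime_spectrum :: "('a, 'b) ring_scheme \<Rightarrow> 'a set set" where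
  "prime_spectrum D = {P. primeideal P D}"

definition max_spectrum :: "('a, 'b) ring_scheme \<Rightarrow> 'a set set" where
  "max_spectrum D = {M. maximalideal M D}"

definition prime_chain :: "('a, 'b) ring_scheme \<Rightarrow> nat \<Rightarrow> (nat \<Rightarrow> 'a set) \<Rightarrow> bool" where
  "prime_chain D n p \<longleftrightarrow>
     (\<forall>i \<le> n. p i \<in> prime_spectrum D) \<and> (\<forall>i < n. p i \<subset> p (Suc i))"

definition has_krull_dim :: "('a, 'b) ring_scheme \<Rightarrow> nat \<Rightarrow> bool" where
  "has_krull_dim D n \<longleftrightarrow>
     (\<exists>p. prime_chain D n p) \<and> (\<forall>m p. prime_chain D m p \<longrightarrow> m \<le> n)"

definition ideal_inverse :: "('a, 'b) ring_scheme \<Rightarrow> 'a set \<Rightarrow> 'a set \<Rightarrow> 'a set" where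
  "ideal_inverse K D I = {x \<in> carrier K. \<forall>a \<in> I. x \<otimes>\<^bsub>K\<^esub> a \<in> D}"

text \<open>
  The product of fractional ideals is taken in \<open>K\<close>: \<open>ideal_prod K I J\<close> consists of the finite
  sums of products of an element of \<open>I\<close> and an element of \<open>J\<close>.
\<close>

definition invertible_ideal :: "('a, 'b) ring_scheme \<Rightarrow> 'a set \<Rightarrow> 'a set \<Rightarrow> bool" where
  "invertible_ideal K D I \<longleftrightarrow> ideal_prod K I (ideal_inverse K D I) = D"

definition pruefer_domain :: "('a, 'b) ring_scheme \<Rightarrow> 'a set \<Rightarrow> bool" where
  "pruefer_domain K D \<longleftrightarrow>
     has_quotient_field K D \<and>
     (\<forall>A. finite A \<and> A \<subseteq> D \<and> Idl\<^bsub>K\<lparr>carrier := D\<rparr>\<^esub> A \<noteq> {\<zero>\<^bsub>K\<^esub>} \<longrightarrow>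
          invertible_ideal K D (Idl\<^bsub>K\<lparr>carrier := D\<rparr>\<^esub> A))"

definition localization :: "('a, 'b) ring_scheme \<Rightarrow> 'a set \<Rightarrow> 'a set \<Rightarrow> 'a set" where
  "localization K D P = {a \<otimes>\<^bsub>K\<^esub> inv\<^bsub>K\<^esub> s | a s. a \<in> D \<and> s \<in> D - P}"

definition overring :: "('a, 'b) ring_scheme \<Rightarrow> 'a set \<Rightarrow> 'a set \<Rightarrow> bool" where
  "overring K D E \<longleftrightarrow> subring E K \<and> D \<subseteq> E"

text \<open>
  The intersection is formed inside \<open>K\<close>, so the empty family gives \<open>carrier K\<close>, which is also
  the localization at the zero ideal.
\<close>

definition intersection_of_localizations ::
    "('a, 'b) ring_scheme \<Rightarrow> 'a set \<Rightarrow> 'a set \<Rightarrow> bool" where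
  "intersection_of_localizations K D E \<longleftrightarrow>
     (\<exists>S \<subseteq> prime_spectrum (K\<lparr>carrier := D\<rparr>).
        E = carrier K \<inter> (\<Inter>P \<in> S. localization K D P))"

text \<open>
  \<open>ring.simple_extension K D u\<close> is the set of values at \<open>u\<close> of polynomials with coefficients in
  \<open>D\<close> (generated by Horner's scheme), that is, \<open>D[u]\<close>.
\<close>

definition sQQR_domain :: "('a, 'b) ring_scheme \<Rightarrow> 'a set \<Rightarrow> bool" where
  "sQQR_domain K D \<longleftrightarrow>
     has_quotient_field K D \<and>
     (\<forall>u \<in> carrier K. intersection_of_localizations K D (ring.simple_extension K D u))"

definition QQR_domain :: "('a, 'b) ring_scheme \<Rightarrow> 'a set \<Rightarrow> bool" where
  "QQR_domain K D \<longleftrightarrow>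
     has_quotient_field K D \<and>
     (\<forall>E. overring K D E \<longrightarrow> intersection_of_localizations K D E)"

definition canonical_preimage :: "('a, 'b) ring_scheme \<Rightarrow> 'a set \<Rightarrow> 'a set set \<Rightarrow> 'a set" where
  "canonical_preimage T M F = {x \<in> carrier T. M +>\<^bsub>T\<^esub> x \<in> F}"

end

theory Submission
  imports Defs
begin

text \<open>
  Write \<open>J = {x \<in> T. x u \<in> T}\<close>; invertibility of the ideal \<open>(1, u)\<close> gives \<open>a, b \<in> J\<close> with
  \<open>a + b u = 1\<close>. Together with dimension one this shows that \<open>T[u]\<close> is the intersection of the
  \<open>T\<^bsub>P\<^esub>\<close>, \<open>P\<close> maximal, that contain \<open>u\<close>, and by (2) and (3) the ideal \<open>M\<close> can be left out of this
  intersection. For \<open>P \<noteq> M\<close> the ring \<open>T\<^bsub>P\<^esub>\<close> is the localization of \<open>R\<close> at \<open>P \<inter> R\<close>.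
  Maximality of \<open>F\<close> makes \<open>T/M\<close> algebraic over \<open>F\<close>, so no ring lies properly between \<open>R\<close> and \<open>T\<close>.
  Consequently \<open>R[u] = T[u]\<close> if \<open>u \<notin> R\<^bsub>M\<^esub>\<close>, while \<open>R[u] = R\<^bsub>M\<^esub> \<inter> T[u]\<close> if \<open>u \<in> R\<^bsub>M\<^esub>\<close>,
  and \<open>R\<close> is an sQQR-domain. On the other hand, the only localization of \<open>R\<close> at a prime ideal that
  contains \<open>T\<^bsub>M\<^esub>\<close> is the quotient field, so the overring \<open>T\<^bsub>M\<^esub>\<close> is not an intersection of
  localizations of \<open>R\<close>; and \<open>T\<^bsub>M\<^esub> = R\<^bsub>M\<^esub>[t]\<close> for each \<open>t \<in> T - R\<close>.
\<close>

text \<open>Zorn's lemma on the ideals that contain \<open>I\<close> but not \<open>\<one>\<close>: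
  the union bounds a nonempty chain, and an ideal strictly above a maximal member must contain
  \<open>\<one>\<close>.\<close>

lemma (in cring) exists_maximalideal:
  assumes "ideal I R" "\<one> \<notin> I"
  shows "\<exists>M. maximalideal M R \<and> I \<subseteq> M"
proof -
  let ?A = "{J. ideal J R \<and> I \<subseteq> J \<and> \<one> \<notin> J}"
  have "\<exists>U\<in>?A. \<forall>J\<in>C. J \<subseteq> U" if C: "subset.chain ?A C" for C
  proof (cases "C = {}")
    case True
    then show ?thesis using assms by auto
  next
    case False
    have "subset.chain {I. ideal I R} C"
      using C unfolding pred_on.chain_def by auto
    then have "ideal (\<Union>C) R"
      using chain_Union_is_ideal[of C] False by simp
    moreover have "I \<subseteq> \<Union>C" "\<one> \<notin> \<Union>C"
      using C False unfolding pred_on.chain_def by blast+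
    ultimately show ?thesis by blast
  qed
  then obtain M where M: "M \<in> ?A" "\<And>J. J \<in> ?A \<Longrightarrow> M \<subseteq> J \<Longrightarrow> J = M"
    using subset_Zorn[of ?A] by auto
  have "maximalideal M R"
  proof (rule maximalidealI)
    show "ideal M R" "carrier R \<noteq> M" using M(1) by auto
    fix J assume J: "ideal J R" "M \<subseteq> J" "J \<subseteq> carrier R"
    show "J = M \<or> J = carrier R"
    proof (cases "\<one> \<in> J")
      case True
      then show ?thesis using ideal.one_imp_carrier[OF J(1)] by blast
    next
      case False
      then have "J \<in> ?A" using M(1) J by blast
      then show ?thesis using M(2) J(2) by blast
    qed
  qed
  then show ?thesis using M(1) by blast
qed

section \<open>Ideals, primes and localizations of subrings of a field\<close>

context field
begin

lemma subring_cring: "subring D R \<Longrightarrow> cring (R\<lparr>carrier := D\<rparr>)"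
  using subcring_iff subcringI' subringE(1) by blast

text \<open>Additive inverses come from multiplication by \<open>\<ominus> \<one>\<close>, an
  element of \<open>D\<close>. The criterion trades the operations of the record for those of the
  field; most ideals below are checked through it.\<close>

lemma ideal_subring_iff:
  assumes D: "subring D R"
  shows "ideal I (R\<lparr>carrier := D\<rparr>) \<longleftrightarrow>
    I \<subseteq> D \<and> \<zero> \<in> I \<and> (\<forall>a\<in>I. \<forall>b\<in>I. a \<oplus> b \<in> I) \<and> (\<forall>a\<in>I. \<forall>x\<in>D. x \<otimes> a \<in> I)"
    (is "?l \<longleftrightarrow> ?r")
proof
  interpret D: cring "R\<lparr>carrier := D\<rparr>" using D by (rule subring_cring)
  note DR = subringE(1)[OF D]
  show ?r if ?l
  proof -
    interpret ideal I "R\<lparr>carrier := D\<rparr>" by fact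
    show ?r
      using a_subset zero_closed I_l_closed a_closed by auto
  qed
  show ?l if r: ?r
  proof (rule idealI)
    show "ring (R\<lparr>carrier := D\<rparr>)" by (rule D.ring_axioms)
    show "x \<otimes>\<^bsub>R\<lparr>carrier := D\<rparr>\<^esub> a \<in> I" if "a \<in> I" "x \<in> carrier (R\<lparr>carrier := D\<rparr>)" for a x
      using r that by simp
    show "a \<otimes>\<^bsub>R\<lparr>carrier := D\<rparr>\<^esub> x \<in> I" if "a \<in> I" "x \<in> carrier (R\<lparr>carrier := D\<rparr>)" for a x
      using r that D.m_comm[of a x] by auto
    show "subgroup I (add_monoid (R\<lparr>carrier := D\<rparr>))"
    proof (rule D.add.subgroupI)
      show "I \<subseteq> carrier (R\<lparr>carrier := D\<rparr>)" "I \<noteq> {}" using r by auto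
      show "a \<oplus>\<^bsub>R\<lparr>carrier := D\<rparr>\<^esub> b \<in> I" if "a \<in> I" "b \<in> I" for a b
        using r that by simp
      show "\<ominus>\<^bsub>R\<lparr>carrier := D\<rparr>\<^esub> a \<in> I" if "a \<in> I" for a
      proof -
        have "a \<in> carrier (R\<lparr>carrier := D\<rparr>)" using r that by auto
        then have "\<ominus>\<^bsub>R\<lparr>carrier := D\<rparr>\<^esub> a = (\<ominus>\<^bsub>R\<lparr>carrier := D\<rparr>\<^esub> \<one>\<^bsub>R\<lparr>carrier := D\<rparr>\<^esub>) \<otimes>\<^bsub>R\<lparr>carrier := D\<rparr>\<^esub> a"
          using D.l_minus[of "\<one>\<^bsub>R\<lparr>carrier := D\<rparr>\<^esub>" a] D.one_closed D.l_one[of a] by metis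
        moreover have "\<ominus>\<^bsub>R\<lparr>carrier := D\<rparr>\<^esub> \<one>\<^bsub>R\<lparr>carrier := D\<rparr>\<^esub> \<in> D"
          using D.a_inv_closed[OF D.one_closed] by simp
        ultimately show ?thesis using r that by simp
      qed
    qed
  qed
qed

lemma one_notin_ideal_iff:
  assumes D: "subring D R" and I: "ideal I (R\<lparr>carrier := D\<rparr>)"
  shows "D \<noteq> I \<longleftrightarrow> \<one> \<notin> I"
  using ideal.one_imp_carrier[OF I] subringE(3)[OF D] by auto

lemma primeideal_subring_iff:
  assumes D: "subring D R"
  shows "primeideal P (R\<lparr>carrier := D\<rparr>) \<longleftrightarrow>
    P \<subseteq> D \<and> \<zero> \<in> P \<and> (\<forall>a\<in>P. \<forall>b\<in>P. a \<oplus> b \<in> P) \<and> (\<forall>a\<in>P. \<forall>x\<in>D. x \<otimes> a \<in> P) \<and>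
    \<one> \<notin> P \<and> (\<forall>a\<in>D. \<forall>b\<in>D. a \<otimes> b \<in> P \<longrightarrow> a \<in> P \<or> b \<in> P)" (is "_ \<longleftrightarrow> ?r")
proof -
  have "primeideal P (R\<lparr>carrier := D\<rparr>) \<longleftrightarrow> ideal P (R\<lparr>carrier := D\<rparr>) \<and> D \<noteq> P \<and>
      (\<forall>a\<in>D. \<forall>b\<in>D. a \<otimes> b \<in> P \<longrightarrow> a \<in> P \<or> b \<in> P)"
    unfolding primeideal_def primeideal_axioms_def using subring_cring[OF D] by auto
  then show ?thesis
    using one_notin_ideal_iff[OF D, of P] ideal_subring_iff[OF D, of P] by blast
qed

lemma primeideal_subringE:
  assumes "subring D R" "primeideal P (R\<lparr>carrier := D\<rparr>)"
  shows "P \<subseteq> D" "\<zero> \<in> P" "\<one> \<notin> P"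
    "\<And>a b. \<lbrakk>a \<in> P; b \<in> P\<rbrakk> \<Longrightarrow> a \<oplus> b \<in> P" "\<And>a x. \<lbrakk>a \<in> P; x \<in> D\<rbrakk> \<Longrightarrow> x \<otimes> a \<in> P"
    "\<And>a b. \<lbrakk>a \<in> D; b \<in> D; a \<otimes> b \<in> P\<rbrakk> \<Longrightarrow> a \<in> P \<or> b \<in> P"
  using assms(2) unfolding primeideal_subring_iff[OF assms(1)] by blast+

lemma maximal_subring_prime:
  "subring D R \<Longrightarrow> maximalideal M (R\<lparr>carrier := D\<rparr>) \<Longrightarrow> primeideal M (R\<lparr>carrier := D\<rparr>)"
  by (rule cring.maximalideal_prime[OF subring_cring])

lemma maximal_subset_prime_eq:
  assumes "subring D R" "maximalideal M (R\<lparr>carrier := D\<rparr>)" "primeideal P (R\<lparr>carrier := D\<rparr>)" "M \<subseteq> P"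
  shows "P = M"
  using maximalideal.I_maximal[OF assms(2), of P] assms(4) primeideal.axioms(1)[OF assms(3)]
    primeideal_subringE[OF assms(1,3)] subringE(3)[OF assms(1)] by auto

lemma zero_primeideal_subring: "subring D R \<Longrightarrow> primeideal {\<zero>} (R\<lparr>carrier := D\<rparr>)"
  using domain.zeroprimeideal[of "R\<lparr>carrier := D\<rparr>"] subdomain_is_domain[OF subdomainI'] by auto

text \<open>Elements outside a prime are nonzero, hence units of the field, so fractions can be
  replaced by cleared denominators. Nearly all arguments about localizations use this form.\<close>

lemma mem_localization:
  assumes D: "subring D R" and P: "primeideal P (R\<lparr>carrier := D\<rparr>)"
  shows "x \<in> localization R D P \<longleftrightarrow> x \<in> carrier R \<and> (\<exists>s\<in>D - P. s \<otimes> x \<in> D)"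
proof -
  note DR = subringE(1)[OF D]
  have nz: "s \<in> Units R" if "s \<in> D - P" for s
    using that DR primeideal_subringE(2)[OF D P] field_Units by auto
  show ?thesis
  proof
    assume "x \<in> localization R D P"
    then obtain a s where as: "a \<in> D" "s \<in> D - P" "x = a \<otimes> inv s"
      unfolding localization_def by blast
    then have "s \<otimes> x = a"
      using nz[OF as(2)] DR m_lcomm[of s a "inv s"] by auto
    then show "x \<in> carrier R \<and> (\<exists>s\<in>D - P. s \<otimes> x \<in> D)"
      using as nz[OF as(2)] DR by (auto simp: subset_iff intro!: bexI[of _ s])
  next
    assume "x \<in> carrier R \<and> (\<exists>s\<in>D - P. s \<otimes> x \<in> D)"
    then obtain s where s: "x \<in> carrier R" "s \<in> D - P" "s \<otimes> x \<in> D" by blast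
    have "x = (s \<otimes> x) \<otimes> inv s"
      using s(1) nz[OF s(2)] m_comm[of s x] m_assoc[of x s "inv s"] Units_closed by simp
    then show "x \<in> localization R D P"
      unfolding localization_def using s by blast
  qed
qed

lemma subset_localization:
  assumes "subring D R" "primeideal P (R\<lparr>carrier := D\<rparr>)"
  shows "D \<subseteq> localization R D P"
proof
  fix x assume "x \<in> D"
  then show "x \<in> localization R D P"
    using mem_localization[OF assms, of x] subringE(1,3)[OF assms(1)] primeideal_subringE(3)[OF assms]
    by (auto intro!: bexI[of _ \<one>])
qed

lemma localization_subring:
  assumes D: "subring D R" and P: "primeideal P (R\<lparr>carrier := D\<rparr>)"
  shows "subring (localization R D P) R"
proof (rule subringI)
  note DR = subringE(1)[OF D] and Dc = subringE[OF D] and mem = mem_localization[OF D P]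
    and Pp = primeideal_subringE(6)[OF D P]
  show "localization R D P \<subseteq> carrier R" using mem by auto
  show "\<one> \<in> localization R D P" using subset_localization[OF D P] Dc(3) by auto
  fix x assume "x \<in> localization R D P"
  then obtain s where s: "x \<in> carrier R" "s \<in> D - P" "s \<otimes> x \<in> D" using mem by auto
  have "s \<otimes> \<ominus> x \<in> D" using s DR Dc(5)[OF s(3)] r_minus[of s x] by auto
  then show "\<ominus> x \<in> localization R D P" unfolding mem using s by auto
  fix y assume "y \<in> localization R D P"
  then obtain t where t: "y \<in> carrier R" "t \<in> D - P" "t \<otimes> y \<in> D" using mem by auto
  have st: "s \<otimes> t \<in> D - P" "s \<in> carrier R" "t \<in> carrier R" using s t Dc(6) Pp DR by auto
  have "(s \<otimes> t) \<otimes> (x \<otimes> y) = (s \<otimes> x) \<otimes> (t \<otimes> y)" using st s(1) t(1) by algebra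
  then show "x \<otimes> y \<in> localization R D P" unfolding mem
    using Dc(6)[OF s(3) t(3)] st s(1) t(1) by (auto intro!: bexI[of _ "s \<otimes> t"])
  have "(s \<otimes> t) \<otimes> (x \<oplus> y) = t \<otimes> (s \<otimes> x) \<oplus> s \<otimes> (t \<otimes> y)" using st s(1) t(1) by algebra
  then show "x \<oplus> y \<in> localization R D P" unfolding mem
    using Dc(7)[OF Dc(6)[OF _ s(3)] Dc(6)[OF _ t(3)], of t s] s t st by (auto intro!: bexI[of _ "s \<otimes> t"])
qed

text \<open>The denominators of \<open>x\<close> in \<open>D\<close> form an ideal. If it is proper,
  it lies in a maximal ideal \<open>N\<close>, and then no denominator avoids
  \<open>N\<close>.\<close>

lemma mem_subring_if_locally:
  assumes D: "subring D R" and x: "x \<in> carrier R"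
    and loc: "\<And>N. maximalideal N (R\<lparr>carrier := D\<rparr>) \<Longrightarrow> \<exists>s\<in>D - N. s \<otimes> x \<in> D"
  shows "x \<in> D"
proof (rule ccontr)
  assume xD: "x \<notin> D"
  let ?I = "{d \<in> D. d \<otimes> x \<in> D}"
  note Dc = subringE[OF D]
  have "ideal ?I (R\<lparr>carrier := D\<rparr>)"
    unfolding ideal_subring_iff[OF D] using Dc x by (auto simp: l_distr m_assoc subset_iff)
  moreover have "\<one> \<notin> ?I" using xD x by auto
  ultimately obtain N where N: "maximalideal N (R\<lparr>carrier := D\<rparr>)" "?I \<subseteq> N"
    using cring.exists_maximalideal[OF subring_cring[OF D], of ?I] by auto
  then show False using loc[OF N(1)] by blast
qed

section \<open>Quotient fields and one-dimensional Pruefer domains\<close>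

lemma has_quotient_field_mem:
  assumes q: "has_quotient_field R D" and x: "x \<in> carrier R"
  shows "\<exists>s\<in>D - {\<zero>}. s \<otimes> x \<in> D"
proof -
  have D: "subring D R" using q unfolding has_quotient_field_def by auto
  obtain a b where "a \<in> D" "b \<in> D - {\<zero>}" "x = a \<otimes> inv b"
    using q x unfolding has_quotient_field_def by blast
  \<comment> \<open>The quotient field is the localization at the zero ideal, so
    \<open>mem_localization\<close> clears the denominator.\<close>
  then have "x \<in> localization R D {\<zero>}" unfolding localization_def by blast
  then show ?thesis
    using mem_localization[OF D zero_primeideal_subring[OF D]] by simp
qed

lemma has_quotient_fieldI:
  assumes D: "subring D R" and "\<And>x. x \<in> carrier R \<Longrightarrow> \<exists>s\<in>D - {\<zero>}. s \<otimes> x \<in> D"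
  shows "has_quotient_field R D"
proof -
  have "x \<in> localization R D {\<zero>}" if "x \<in> carrier R" for x
    using mem_localization[OF D zero_primeideal_subring[OF D]] assms(2)[OF that] that by simp
  then show ?thesis
    unfolding has_quotient_field_def localization_def using D field_axioms by blast
qed

text \<open>For a nonzero denominator \<open>d\<close> of \<open>u\<close> the ideal (d, du) is
  invertible. If 1 is a sum of products i j with i = x d + y du and j in the inverse ideal, then a =
  sum of x j d and b = sum of y j d are as required. This is the only consequence of invertibility
  used below.\<close>

lemma pruefer_partition:
  assumes pr: "pruefer_domain R D" and u: "u \<in> carrier R"
  shows "\<exists>a\<in>D. \<exists>b\<in>D. a \<otimes> u \<in> D \<and> b \<otimes> u \<in> D \<and> a \<oplus> b \<otimes> u = \<one>"
proof -
  have q: "has_quotient_field R D" and D: "subring D R"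
    using pr unfolding pruefer_domain_def has_quotient_field_def by auto
  note Dc = subringE[OF D]
  interpret D: cring "R\<lparr>carrier := D\<rparr>" using D by (rule subring_cring)
  obtain d where d: "d \<in> D" "d \<noteq> \<zero>" "d \<otimes> u \<in> D"
    using has_quotient_field_mem[OF q u] by auto
  let ?I = "Idl\<^bsub>R\<lparr>carrier := D\<rparr>\<^esub> {d, d \<otimes> u}"
  let ?G = "{x \<otimes> d \<oplus> y \<otimes> (d \<otimes> u) | x y. x \<in> D \<and> y \<in> D}"
  have sub: "{d, d \<otimes> u} \<subseteq> ?I" using D.genideal_self[of "{d, d \<otimes> u}"] d by simp
  have "ideal ?G (R\<lparr>carrier := D\<rparr>)"
    unfolding ideal_subring_iff[OF D]
  proof (intro conjI ballI)
    show "?G \<subseteq> D" using Dc(6,7) d(1,3) by blast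
    have "\<zero> = \<zero> \<otimes> d \<oplus> \<zero> \<otimes> (d \<otimes> u)" using d u Dc(1) by auto
    then show "\<zero> \<in> ?G" using Dc(2) by blast
    fix a assume "a \<in> ?G"
    then obtain x y where a: "x \<in> D" "y \<in> D" "a = x \<otimes> d \<oplus> y \<otimes> (d \<otimes> u)" by blast
    have cs: "x \<in> carrier R" "y \<in> carrier R" "d \<in> carrier R" using a d Dc(1) by auto
    { fix r assume r: "r \<in> D"
      then have "r \<in> carrier R" using Dc(1) by auto
      then have "r \<otimes> a = (r \<otimes> x) \<otimes> d \<oplus> (r \<otimes> y) \<otimes> (d \<otimes> u)" unfolding a using cs u by algebra
      then show "r \<otimes> a \<in> ?G" using Dc(6) a r by blast }
    fix b assume "b \<in> ?G"
    then obtain x' y' where b: "x' \<in> D" "y' \<in> D" "b = x' \<otimes> d \<oplus> y' \<otimes> (d \<otimes> u)" by blast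
    have "x' \<in> carrier R" "y' \<in> carrier R" using b Dc(1) by auto
    then have "a \<oplus> b = (x \<oplus> x') \<otimes> d \<oplus> (y \<oplus> y') \<otimes> (d \<otimes> u)" unfolding a b using cs u by algebra
    then show "a \<oplus> b \<in> ?G" using Dc(7) a b by blast
  qed
  moreover have "{d, d \<otimes> u} \<subseteq> ?G"
  proof -
    have "d = \<one> \<otimes> d \<oplus> \<zero> \<otimes> (d \<otimes> u)" "d \<otimes> u = \<zero> \<otimes> d \<oplus> \<one> \<otimes> (d \<otimes> u)"
      using d Dc(1) u by auto
    then show ?thesis using Dc(2,3) by blast
  qed
  ultimately have IG: "?I \<subseteq> ?G" using D.genideal_minimal by blast
  have "?I \<noteq> {\<zero>}" using sub d by auto
  then have "invertible_ideal R D ?I"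
    using pr d unfolding pruefer_domain_def by simp
  then have "\<one> \<in> ideal_prod R ?I (ideal_inverse R D ?I)"
    using Dc(3) unfolding invertible_ideal_def by simp
  \<comment> \<open>Stated for every \<open>z\<close> of the product, not only
    \<open>\<one>\<close>, so that induction over finite sums applies; the pairs of two summands add
    componentwise.\<close>
  moreover have "\<exists>a\<in>D. \<exists>b\<in>D. a \<otimes> u \<in> D \<and> b \<otimes> u \<in> D \<and> a \<oplus> b \<otimes> u = z"
    if "z \<in> ideal_prod R ?I (ideal_inverse R D ?I)" for z
    using that
  proof induct
    case (prod i j)
    obtain x y where i: "x \<in> D" "y \<in> D" "i = x \<otimes> d \<oplus> y \<otimes> (d \<otimes> u)" using prod(1) IG by blast
    have j: "j \<in> carrier R" "j \<otimes> d \<in> D" "j \<otimes> (d \<otimes> u) \<in> D"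
      using prod(2) sub unfolding ideal_inverse_def by auto
    have cs: "x \<in> carrier R" "y \<in> carrier R" "d \<in> carrier R" using i d Dc(1) by auto
    have "(x \<otimes> (j \<otimes> d)) \<otimes> u = x \<otimes> (j \<otimes> (d \<otimes> u))" "(y \<otimes> (j \<otimes> d)) \<otimes> u = y \<otimes> (j \<otimes> (d \<otimes> u))"
      "x \<otimes> (j \<otimes> d) \<oplus> (y \<otimes> (j \<otimes> d)) \<otimes> u = i \<otimes> j"
      unfolding i using cs j u by algebra+
    then show ?case using Dc(6) i(1,2) j(2,3)
      by (intro bexI[of _ "x \<otimes> (j \<otimes> d)"] bexI[of _ "y \<otimes> (j \<otimes> d)"]) auto
  next
    case (sum z1 z2)
    then obtain a b a' b' where *: "a \<in> D" "b \<in> D" "a \<otimes> u \<in> D" "b \<otimes> u \<in> D" "a \<oplus> b \<otimes> u = z1"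
      "a' \<in> D" "b' \<in> D" "a' \<otimes> u \<in> D" "b' \<otimes> u \<in> D" "a' \<oplus> b' \<otimes> u = z2" by blast
    have cs: "a \<in> carrier R" "b \<in> carrier R" "a' \<in> carrier R" "b' \<in> carrier R" using * Dc(1) by auto
    have "(a \<oplus> a') \<otimes> u = a \<otimes> u \<oplus> a' \<otimes> u" "(b \<oplus> b') \<otimes> u = b \<otimes> u \<oplus> b' \<otimes> u"
      "(a \<oplus> a') \<oplus> (b \<oplus> b') \<otimes> u = z1 \<oplus> z2"
      unfolding *(5,10)[symmetric] using cs u by algebra+
    then show ?case using Dc(7) *
      by (intro bexI[of _ "a \<oplus> a'"] bexI[of _ "b \<oplus> b'"]) auto
  qed
  ultimately show ?thesis by blast
qed

text \<open>Membership in D[u] is tested at each maximal ideal \<open>N\<close> of D[u]. Over the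
  zero ideal of \<open>D\<close> any nonzero denominator of \<open>x\<close> in \<open>D\<close>
  avoids \<open>N\<close>; otherwise \<open>N\<close> contracts to a maximal ideal whose
  localization contains \<open>u\<close>, and \<open>loc\<close> provides the denominator.\<close>

lemma pruefer_simple_overring_mem:
  assumes pr: "pruefer_domain R D"
    and dim: "\<And>P. primeideal P (R\<lparr>carrier := D\<rparr>) \<Longrightarrow> P \<noteq> {\<zero>} \<Longrightarrow> maximalideal P (R\<lparr>carrier := D\<rparr>)"
    and u: "u \<in> carrier R" and x: "x \<in> carrier R"
    and loc: "\<And>P. maximalideal P (R\<lparr>carrier := D\<rparr>) \<Longrightarrow> u \<in> localization R D P \<Longrightarrow> x \<in> localization R D P"
  shows "x \<in> simple_extension D u"
proof -
  have q: "has_quotient_field R D" and D: "subring D R"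
    using pr unfolding pruefer_domain_def has_quotient_field_def by auto
  let ?E = "simple_extension D u"
  note Dc = subringE[OF D]
  have E: "subring ?E R" using simple_extension_is_subring[OF D u] .
  have DE: "D \<subseteq> ?E" and uE: "u \<in> ?E"
    using simple_extension_incl[OF Dc(1) u] simple_extension_mem[OF D u] by auto
  show ?thesis
  proof (rule mem_subring_if_locally[OF E x])
    fix N assume N': "maximalideal N (R\<lparr>carrier := ?E\<rparr>)"
    have N: "primeideal N (R\<lparr>carrier := ?E\<rparr>)" by (rule maximal_subring_prime[OF E N'])
    note Np = primeideal_subringE[OF E N]
    let ?P = "N \<inter> D"
    have P: "primeideal ?P (R\<lparr>carrier := D\<rparr>)"
      unfolding primeideal_subring_iff[OF D]
    proof (intro conjI ballI impI)
      show "?P \<subseteq> D" "\<zero> \<in> ?P" "\<one> \<notin> ?P" using Np(2,3) Dc(2) by auto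
      show "a \<oplus> b \<in> ?P" if "a \<in> ?P" "b \<in> ?P" for a b using Np(4) Dc(7) that by auto
      show "x \<otimes> a \<in> ?P" if "a \<in> ?P" "x \<in> D" for a x using Np(5) Dc(6) DE that by auto
      show "a \<in> ?P \<or> b \<in> ?P" if "a \<in> D" "b \<in> D" "a \<otimes> b \<in> ?P" for a b
        using Np(6)[of a b] DE that by auto
    qed
    show "\<exists>s\<in>?E - N. s \<otimes> x \<in> ?E"
    proof (cases "?P = {\<zero>}")
      case True
      then show ?thesis using has_quotient_field_mem[OF q x] DE by blast
    next
      case False
      then have Pm: "maximalideal ?P (R\<lparr>carrier := D\<rparr>)" using dim P by blast
      obtain a b where ab: "a \<in> D" "b \<in> D" "a \<otimes> u \<in> D" "b \<otimes> u \<in> D" "a \<oplus> b \<otimes> u = \<one>"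
        using pruefer_partition[OF pr u] by blast
      \<comment> \<open>Since \<open>u\<close> lies in D[u], having both in \<open>N\<close> would
        put 1 = a + bu in \<open>N\<close>. The one outside is a denominator of
        \<open>u\<close>.\<close>
      have "a \<notin> ?P \<or> b \<notin> ?P"
      proof (rule ccontr)
        assume "\<not> ?thesis"
        then have "a \<in> N" "b \<in> N" by auto
        then have "a \<oplus> u \<otimes> b \<in> N" using Np(4,5) uE by blast
        then show False using Np(3) ab m_comm[OF u, of b] Dc(1) by auto
      qed
      then have "u \<in> localization R D ?P" unfolding mem_localization[OF D P] using ab u by blast
      then have "x \<in> localization R D ?P" using loc[OF Pm] by blast
      then show ?thesis unfolding mem_localization[OF D P] using DE by blast
    qed
  qed
qed

text \<open>A nonzero prime strictly inside a maximal ideal would give a chain of length two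
  starting at the zero ideal.\<close>

lemma dim_one_prime_maximal:
  assumes D: "subring D R" and dim: "has_krull_dim (R\<lparr>carrier := D\<rparr>) 1"
    and P: "primeideal P (R\<lparr>carrier := D\<rparr>)" and nz: "P \<noteq> {\<zero>}"
  shows "maximalideal P (R\<lparr>carrier := D\<rparr>)"
proof -
  have "ideal P (R\<lparr>carrier := D\<rparr>)" using P primeideal.axioms(1) by blast
  then obtain M where M: "maximalideal M (R\<lparr>carrier := D\<rparr>)" "P \<subseteq> M"
    using cring.exists_maximalideal[OF subring_cring[OF D], of P] primeideal_subringE(3)[OF D P] by auto
  have "P = M"
  proof (rule ccontr)
    assume ne: "P \<noteq> M"
    define p where "p i = (if i = 0 then {\<zero>} else if i = 1 then P else M)" for i :: nat
    have "prime_chain (R\<lparr>carrier := D\<rparr>) 2 p"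
      unfolding prime_chain_def prime_spectrum_def
      using zero_primeideal_subring[OF D] P maximal_subring_prime[OF D M(1)] ne M(2) nz
        primeideal_subringE(2)[OF D P]
      by (auto simp: p_def less_Suc_eq numeral_2_eq_2)
    then show False using dim unfolding has_krull_dim_def by fastforce
  qed
  then show ?thesis using M by simp
qed

text \<open>If \<open>x\<close> is not in D_M, both coefficients of a + bx = 1 lie in
  \<open>M\<close>, so bx does not. With a denominator \<open>s\<close> of \<open>u\<close> outside
  \<open>M\<close>, the element s(bx) avoids infinitely many \<open>P\<close>, while
  \<open>b\<close> lies in almost all of them. A prime \<open>P\<close> with both properties has
  \<open>u\<close>, hence \<open>x\<close>, in D_P, and this contradicts the choice of
  \<open>P\<close>.\<close>

lemma pruefer_mem_localization:
  assumes pr: "pruefer_domain R D" and M: "maximalideal M (R\<lparr>carrier := D\<rparr>)"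
    and \<P>: "\<And>P. P \<in> \<P> \<Longrightarrow> maximalideal P (R\<lparr>carrier := D\<rparr>)"
    and almost_all: "\<And>a. a \<in> M \<Longrightarrow> finite {P \<in> \<P>. a \<notin> P}"
    and inf_many: "\<And>a. a \<in> D - M \<Longrightarrow> infinite {P \<in> \<P>. a \<notin> P}"
    and u: "u \<in> localization R D M" and x: "x \<in> carrier R"
    and loc: "\<And>P. P \<in> \<P> \<Longrightarrow> P \<noteq> M \<Longrightarrow> u \<in> localization R D P \<Longrightarrow> x \<in> localization R D P"
  shows "x \<in> localization R D M"
proof (rule ccontr)
  assume nx: "x \<notin> localization R D M"
  have D: "subring D R" using pr unfolding pruefer_domain_def has_quotient_field_def by auto
  have Mp: "primeideal M (R\<lparr>carrier := D\<rparr>)" using maximal_subring_prime[OF D M] .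
  note Dc = subringE[OF D] and Mc = primeideal_subringE[OF D Mp] and mem = mem_localization[OF D Mp]
  obtain a b where ab: "a \<in> D" "b \<in> D" "a \<otimes> x \<in> D" "b \<otimes> x \<in> D" "a \<oplus> b \<otimes> x = \<one>"
    using pruefer_partition[OF pr x] by blast
  have M': "a \<in> M" "b \<in> M" using nx ab(1-4) x unfolding mem by blast+
  have w: "b \<otimes> x \<notin> M" using Mc(3) Mc(4)[OF M'(1), of "b \<otimes> x"] ab(5) by auto
  obtain s where s: "u \<in> carrier R" "s \<in> D" "s \<notin> M" "s \<otimes> u \<in> D" using u unfolding mem by blast
  have "s \<otimes> (b \<otimes> x) \<in> D - M" using Mc(6)[OF s(2) ab(4)] Dc(6)[OF s(2) ab(4)] s(3) w by blast
  \<comment> \<open>\<open>M\<close> is taken out as well because \<open>\<P>\<close> is not assumed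
    to avoid it, and \<open>loc\<close> only speaks of \<open>P \<noteq> M\<close>.\<close>
  then have "infinite ({P \<in> \<P>. s \<otimes> (b \<otimes> x) \<notin> P} - {P \<in> \<P>. b \<notin> P} - {M})"
    using inf_many almost_all[OF M'(2)] by auto
  then obtain P where P: "P \<in> \<P>" "s \<otimes> (b \<otimes> x) \<notin> P" "b \<in> P" "P \<noteq> M"
    using infinite_imp_nonempty by blast
  have Pp: "primeideal P (R\<lparr>carrier := D\<rparr>)" using maximal_subring_prime[OF D \<P>[OF P(1)]] .
  note Pc = primeideal_subringE[OF D Pp]
  have "s \<notin> P"
    using Pc(5)[of s "b \<otimes> x"] P(2) ab(4) m_comm[of s "b \<otimes> x"] s(2) Dc(1) by (auto simp: subset_iff)
  then have "u \<in> localization R D P" unfolding mem_localization[OF D Pp] using s by blast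
  then have "x \<in> localization R D P" using loc P by blast
  then obtain r where r: "r \<in> D" "r \<notin> P" "r \<otimes> x \<in> D" unfolding mem_localization[OF D Pp] by blast
  have "r \<in> carrier R" "b \<in> carrier R" using r ab(2) Dc(1) by auto
  \<comment> \<open>The factor \<open>b\<close> puts this product into \<open>P\<close>; as
    \<open>r\<close> is outside \<open>P\<close>, bx must be in \<open>P\<close>.\<close>
  then have "r \<otimes> (b \<otimes> x) = (r \<otimes> x) \<otimes> b" using x by algebra
  also have "\<dots> \<in> P" using Pc(5) P(3) r(3) by blast
  finally have "b \<otimes> x \<in> P" using Pc(6)[OF r(1) ab(4)] r(2) by blast
  then show False using Pc(5) s(2) P(2) by blast
qed

section \<open>Maximal subfields and simple extensions\<close>

lemma localization_zero_subfield:
  assumes D: "subring D R"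
  shows "subfield (localization R D {\<zero>}) R"
proof (rule subfieldI')
  note Z = zero_primeideal_subring[OF D] and mem = mem_localization[OF D zero_primeideal_subring[OF D]]
  show "subring (localization R D {\<zero>}) R" by (rule localization_subring[OF D Z])
  fix x assume "x \<in> localization R D {\<zero>} - {\<zero>}"
  then obtain s where s: "x \<in> carrier R" "x \<noteq> \<zero>" "s \<in> D" "s \<noteq> \<zero>" "s \<otimes> x \<in> D"
    using mem[of x] by auto
  have U: "x \<in> Units R" and sc: "s \<in> carrier R" using s field_Units subringE(1)[OF D] by auto
  have "s \<otimes> x \<noteq> \<zero>" using integral[OF _ sc s(1)] s by blast
  moreover have "(s \<otimes> x) \<otimes> inv x = s" using U sc s(1) m_assoc[of s x "inv x"] by simp
  ultimately show "inv x \<in> localization R D {\<zero>}"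
    unfolding mem using s U by (auto intro!: bexI[of _ "s \<otimes> x"])
qed

text \<open>A Horner step in x^2 is two Horner steps in \<open>x\<close>, appending
  \<open>\<zero>\<close> and \<open>c\<close>, so the parity of the length is kept; odd length means
  even degree. The value \<open>\<zero>\<close> is excluded because it starts from the empty list,
  whose length is even.\<close>

lemma simple_extension_square_eval:
  assumes F: "subfield F R" and x: "x \<in> carrier R"
    and z: "z \<in> simple_extension F (x \<otimes> x)" "z \<noteq> \<zero>"
  shows "\<exists>p. polynomial F p \<and> odd (length p) \<and> eval p x = z"
  using z
proof induct
  case zero
  then show ?case by simp
next
  case (lin k c)
  note FR = subfieldE(3)[OF F]
  have c: "c \<in> carrier R" "k \<in> carrier R"
    using lin FR simple_extension_in_carrier[OF FR, of "x \<otimes> x"] x by auto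
  show ?case
  proof (cases "k = \<zero>")
    case True
    \<comment> \<open>A vanishing prefix is dropped and the list restarts with \<open>c\<close>,
      which is nonzero because the whole value is.\<close>
    then have "polynomial F [c]" "eval [c] x = k \<otimes> (x \<otimes> x) \<oplus> c"
      using lin c x unfolding polynomial_def by auto
    then show ?thesis by (intro exI[of _ "[c]"]) auto
  next
    case False
    then obtain p where p: "polynomial F p" "odd (length p)" "eval p x = k" using lin by blast
    have ne: "p \<noteq> []" using p(2) by auto
    have pc: "set p \<subseteq> carrier R" using p(1) FR unfolding polynomial_def by auto
    have "polynomial F ((p @ [\<zero>]) @ [c])"
      using p(1) lin(3) ne subringE(2)[OF subfieldE(1)[OF F]] unfolding polynomial_def by auto
    moreover have "eval ((p @ [\<zero>]) @ [c]) x = (k \<otimes> x \<oplus> \<zero>) \<otimes> x \<oplus> c"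
      using eval_append_aux[of "p @ [\<zero>]" c x] eval_append_aux[of p \<zero> x] pc c x p(3) by simp
    moreover have "(k \<otimes> x \<oplus> \<zero>) \<otimes> x \<oplus> c = k \<otimes> (x \<otimes> x) \<oplus> c" using c x by algebra
    ultimately show ?thesis using p(2) by (intro exI[of _ "(p @ [\<zero>]) @ [c]"]) simp
  qed
qed

text \<open>If \<open>x\<^sup>2\<close> is not in \<open>F\<close>, maximality puts \<open>x\<close> in \<open>F(x\<^sup>2)\<close>; clearing denominators gives an equation
  between a polynomial of odd degree in \<open>x\<close> and one of even degree, so \<open>x\<close> is algebraic over \<open>F\<close>.\<close>

lemma maximal_subfield_algebraic:
  assumes F: "subfield F R" and x: "x \<in> carrier R - F"
    and max: "\<And>L. subfield L R \<Longrightarrow> F \<subset> L \<Longrightarrow> L = carrier R"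
  shows "(algebraic over F) x"
proof -
  have xc: "x \<in> carrier R" and y: "x \<otimes> x \<in> carrier R" using x by auto
  have Fs: "subring F R" and FR: "F \<subseteq> carrier R" using subfieldE(1,3)[OF F] by auto
  have x0: "x \<noteq> \<zero>" using x subringE(2)[OF Fs] by auto
  show ?thesis
  proof (cases "x \<otimes> x \<in> F")
    case True
    have "polynomial F [\<one>, \<zero>, \<ominus> (x \<otimes> x)]"
      using subringE(2,3,5)[OF Fs] True unfolding polynomial_def by auto
    moreover have "eval [\<one>, \<zero>, \<ominus> (x \<otimes> x)] x = \<zero>"
      using xc by (simp add: numeral_2_eq_2 r_neg)
    ultimately show ?thesis
      by (intro algebraicI[of "[\<one>, \<zero>, \<ominus> (x \<otimes> x)]"]) (auto simp: univ_poly_carrier)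
  next
    case False
    let ?D = "simple_extension F (x \<otimes> x)"
    have D: "subring ?D R" using simple_extension_is_subring[OF Fs y] .
    let ?L = "localization R ?D {\<zero>}"
    have DL: "?D \<subseteq> ?L" using subset_localization[OF D zero_primeideal_subring[OF D]] .
    have "F \<subset> ?L"
      using DL simple_extension_incl[OF FR y] simple_extension_mem[OF Fs y] False by blast
    then have "?L = carrier R" using max localization_zero_subfield[OF D] by blast
    then have "x \<in> ?L" using xc by simp
    then obtain q where q: "q \<in> ?D" "q \<noteq> \<zero>" "q \<otimes> x \<in> ?D"
      unfolding mem_localization[OF D zero_primeideal_subring[OF D]] by blast
    have qc: "q \<in> carrier R" using q subringE(1)[OF D] by auto
    have nz: "\<ominus> (q \<otimes> x) \<noteq> \<zero>"
      using integral[OF _ qc xc] q(2) x0 qc xc by (metis m_closed minus_minus minus_zero)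
    obtain p1 where p1: "polynomial F p1" "odd (length p1)" "eval p1 x = q"
      using simple_extension_square_eval[OF F xc q(1,2)] by blast
    obtain p2 where p2: "polynomial F p2" "odd (length p2)" "eval p2 x = \<ominus> (q \<otimes> x)"
      using simple_extension_square_eval[OF F xc subringE(5)[OF D q(3)] nz] by blast
    have "p1 \<noteq> []" using p1(2) by auto
    then have p1': "polynomial F (p1 @ [\<zero>])"
      using p1(1) subringE(2)[OF Fs] unfolding polynomial_def by auto
    have pc: "set p1 \<subseteq> carrier R" "set p2 \<subseteq> carrier R"
      using p1(1) p2(1) FR unfolding polynomial_def by auto
    let ?p = "poly_add (p1 @ [\<zero>]) p2"
    have "eval ?p x = (q \<otimes> x \<oplus> \<zero>) \<oplus> \<ominus> (q \<otimes> x)"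
      using eval_poly_add[of "p1 @ [\<zero>]" p2 x] eval_append_aux[of p1 \<zero> x] pc xc p1(3) p2(3) by simp
    then have "eval ?p x = \<zero>" using qc xc by (simp add: r_neg)
    moreover have "set (p1 @ [\<zero>]) \<subseteq> F" "set p2 \<subseteq> F" using p1' p2(1) unfolding polynomial_def by auto
    then have "polynomial F ?p" by (rule poly_add_is_polynomial[OF Fs])
    \<comment> \<open>The degrees are \<open>length p1\<close>, odd, and
      \<open>length p2 - 1\<close>, even. Hence the leading terms cannot cancel.\<close>
    moreover have "?p \<noteq> []"
    proof -
      have len: "length p1 > 0" "length p2 > 0" using p1(2) p2(2) odd_pos by blast+
      then have "degree (p1 @ [\<zero>]) \<noteq> degree p2"
        using p1(2) p2(2) by (metis Suc_diff_1 diff_Suc_1 even_Suc length_append_singleton)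
      then have "degree ?p = max (degree (p1 @ [\<zero>])) (degree p2)"
        using poly_add_degree_eq[OF Fs p1' p2(1)] by blast
      then show ?thesis using len by (auto simp del: poly_add.simps)
    qed
    ultimately show ?thesis using algebraicI[of ?p F x] by (simp add: univ_poly_carrier del: poly_add.simps)
  qed
qed

text \<open>Algebraicity makes F[x] a field, to which maximality applies.\<close>

corollary maximal_subfield_simple_extension:
  assumes F: "subfield F R" and x: "x \<in> carrier R - F"
    and max: "\<And>L. subfield L R \<Longrightarrow> F \<subset> L \<Longrightarrow> L = carrier R"
  shows "simple_extension F x = carrier R"
proof (rule max)
  show "subfield (simple_extension F x) R"
    using simple_extension_is_subfield[OF F] maximal_subfield_algebraic[OF F x max] x by blast
  show "F \<subset> simple_extension F x"
    using simple_extension_incl[OF subfieldE(3)[OF F], of x]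
      simple_extension_mem[OF subfieldE(1)[OF F], of x] x by blast
qed

end

text \<open>Isolates what the argument needs from the quotient ring and from \<open>\<P>\<close>.
  \<open>R_inverse\<close> says that R/M is a field; \<open>R_minimal\<close> excludes rings
  properly between \<open>R\<close> and \<open>T\<close>, in a form usable for overrings
  \<open>A\<close> not contained in \<open>T\<close>; the last assumption lets T_M be omitted from
  the intersection for T[u].\<close>

locale minimal_pullback = field K for K (structure) +
  fixes T M R
  assumes pruefer: "pruefer_domain K T"
    and dim: "has_krull_dim (K\<lparr>carrier := T\<rparr>) 1"
    and M_max: "maximalideal M (K\<lparr>carrier := T\<rparr>)"
    and M_nz: "M \<noteq> {\<zero>}"
    and R_subring: "subring R K"
    and M_R: "M \<subseteq> R" and R_T: "R \<subset> T"
    and R_inverse: "\<And>s. s \<in> R - M \<Longrightarrow> \<exists>s'\<in>R. \<exists>m\<in>M. s' \<otimes> s = \<one> \<oplus> m"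
    and R_minimal: "\<And>A t. \<lbrakk>subring A K; R \<subseteq> A; t \<in> A; t \<in> T - R\<rbrakk> \<Longrightarrow> T \<subseteq> A"
    and T_M_if_other_localizations: "\<And>u x. \<lbrakk>u \<in> localization K T M; x \<in> carrier K;
      \<And>P. \<lbrakk>maximalideal P (K\<lparr>carrier := T\<rparr>); P \<noteq> M; u \<in> localization K T P\<rbrakk> \<Longrightarrow> x \<in> localization K T P\<rbrakk>
      \<Longrightarrow> x \<in> localization K T M"
begin

section \<open>Prime ideals and localizations of the pullback\<close>

lemma T_quotient: "has_quotient_field K T" and T_subring: "subring T K"
  using pruefer unfolding pruefer_domain_def has_quotient_field_def by auto

lemmas T_props = subringE[OF T_subring]
lemmas R_props = subringE[OF R_subring]

lemma M_prime: "primeideal M (K\<lparr>carrier := T\<rparr>)"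
  using maximal_subring_prime[OF T_subring M_max] .

lemmas M_props = primeideal_subringE[OF T_subring M_prime]

lemma MT_R: "m \<in> M \<Longrightarrow> t \<in> T \<Longrightarrow> t \<otimes> m \<in> R"
  using M_props(5) M_R by blast

lemma M_prime_R: "primeideal M (K\<lparr>carrier := R\<rparr>)"
  unfolding primeideal_subring_iff[OF R_subring]
proof (intro conjI ballI impI)
  show "M \<subseteq> R" "\<zero> \<in> M" "\<one> \<notin> M" using M_R M_props(2,3) by auto
  show "a \<oplus> b \<in> M" if "a \<in> M" "b \<in> M" for a b using M_props(4) that .
  show "x \<otimes> a \<in> M" if "a \<in> M" "x \<in> R" for a x using M_props(5)[of a x] R_T that by auto
  show "a \<in> M \<or> b \<in> M" if "a \<in> R" "b \<in> R" "a \<otimes> b \<in> M" for a b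
    using M_props(6)[of a b] R_T that by auto
qed

lemmas mem_T_M = mem_localization[OF T_subring M_prime]
lemmas mem_R_M = mem_localization[OF R_subring M_prime_R]

text \<open>An element of \<open>Q\<close> outside \<open>M\<close> is invertible modulo
  \<open>M\<close>, which would force \<open>\<one>\<close> into \<open>Q\<close>.\<close>

lemma prime_R_eq_M:
  assumes Q: "primeideal Q (K\<lparr>carrier := R\<rparr>)" and MQ: "M \<subseteq> Q"
  shows "Q = M"
proof (rule ccontr)
  note Qp = primeideal_subringE[OF R_subring Q]
  assume "Q \<noteq> M"
  then obtain s where s: "s \<in> Q" "s \<notin> M" using MQ by blast
  then obtain s' m where s': "s' \<in> R" "m \<in> M" "s' \<otimes> s = \<one> \<oplus> m" using R_inverse Qp(1) by blast
  then have "\<one> \<oplus> m \<in> Q" "\<ominus> \<one> \<otimes> m \<in> Q" using Qp(5) s R_props(3,5) MQ by (metis, blast)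
  then have "(\<one> \<oplus> m) \<oplus> (\<ominus> \<one> \<otimes> m) \<in> Q" using Qp(4) by blast
  moreover have "m \<in> carrier K" using s' M_props(1) T_props(1) by blast
  then have "(\<one> \<oplus> m) \<oplus> (\<ominus> \<one> \<otimes> m) = \<one>" by algebra
  ultimately show False using Qp(3) by simp
qed

lemma prime_restrict:
  assumes P: "primeideal P (K\<lparr>carrier := T\<rparr>)"
  shows "primeideal (P \<inter> R) (K\<lparr>carrier := R\<rparr>)"
  unfolding primeideal_subring_iff[OF R_subring]
proof (intro conjI ballI impI)
  note Pp = primeideal_subringE[OF T_subring P]
  show "P \<inter> R \<subseteq> R" "\<zero> \<in> P \<inter> R" "\<one> \<notin> P \<inter> R" using Pp(2,3) R_props(2) by auto
  show "a \<oplus> b \<in> P \<inter> R" if "a \<in> P \<inter> R" "b \<in> P \<inter> R" for a b using Pp(4) R_props(7) that by auto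
  show "x \<otimes> a \<in> P \<inter> R" if "a \<in> P \<inter> R" "x \<in> R" for a x using Pp(5) R_props(6) R_T that by blast
  show "a \<in> P \<inter> R \<or> b \<in> P \<inter> R" if "a \<in> R" "b \<in> R" "a \<otimes> b \<in> P \<inter> R" for a b
    using Pp(6)[of a b] R_T that by auto
qed

text \<open>An element of \<open>M\<close> outside \<open>P\<close> multiplies \<open>T\<close> into
  \<open>R\<close>. It turns a denominator in \<open>T\<close> into one in \<open>R\<close> that is
  still outside \<open>P\<close>.\<close>

lemma localization_restrict:
  assumes P: "maximalideal P (K\<lparr>carrier := T\<rparr>)" and ne: "P \<noteq> M"
  shows "localization K R (P \<inter> R) = localization K T P"
proof -
  have P': "primeideal P (K\<lparr>carrier := T\<rparr>)" using maximal_subring_prime[OF T_subring P] .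
  note Pp = primeideal_subringE[OF T_subring P'] and memR = mem_localization[OF R_subring prime_restrict[OF P']]
    and memT = mem_localization[OF T_subring P']
  have "\<not> M \<subseteq> P" using maximal_subset_prime_eq[OF T_subring M_max P'] ne by blast
  then obtain m where m: "m \<in> M" "m \<notin> P" by blast
  show ?thesis
  proof (intro equalityI subsetI)
    fix x assume "x \<in> localization K R (P \<inter> R)"
    then show "x \<in> localization K T P" unfolding memR memT using R_T by blast
  next
    fix x assume "x \<in> localization K T P"
    then obtain s where s: "x \<in> carrier K" "s \<in> T" "s \<notin> P" "s \<otimes> x \<in> T" unfolding memT by blast
    have c: "s \<in> carrier K" "m \<in> carrier K" using s m M_props(1) T_props(1) by auto
    have "s \<otimes> m \<in> R" "s \<otimes> m \<notin> P" using MT_R Pp(6)[of s m] s m M_props(1) by auto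
    moreover have "(s \<otimes> m) \<otimes> x = (s \<otimes> x) \<otimes> m" using c s(1) by algebra
    ultimately show "x \<in> localization K R (P \<inter> R)" unfolding memR
      using MT_R[OF m(1) s(4)] s(1) by (auto intro!: bexI[of _ "s \<otimes> m"])
  qed
qed

text \<open>Since \<open>M\<close> is maximal in \<open>T\<close> and contained in \<open>R\<close>, inverting \<open>R - M\<close> already yields \<open>T\<^bsub>M\<^esub>\<close>.\<close>

lemma mem_localization_T_M:
  assumes "x \<in> localization K T M"
  shows "\<exists>s\<in>R - M. s \<otimes> x \<in> T"
proof -
  obtain s where s: "x \<in> carrier K" "s \<in> T - M" "s \<otimes> x \<in> T"
    using assms unfolding mem_T_M by blast
  \<comment> \<open>The ideal Ts + M equals \<open>T\<close> by maximality. In 1 = ys + m the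
    element ys = 1 - m lies in \<open>R\<close> but not in \<open>M\<close>, and as a multiple of
    \<open>s\<close> it is again a denominator of \<open>x\<close>.\<close>
  let ?J = "{y \<otimes> s \<oplus> m | y m. y \<in> T \<and> m \<in> M}"
  have sc: "s \<in> carrier K" using s T_props(1) by auto
  have "ideal ?J (K\<lparr>carrier := T\<rparr>)"
    unfolding ideal_subring_iff[OF T_subring]
  proof (intro conjI ballI)
    show "?J \<subseteq> T" using T_props(6,7) s(2) M_props(1) by blast
    have "\<zero> = \<zero> \<otimes> s \<oplus> \<zero>" using sc by simp
    then show "\<zero> \<in> ?J" using T_props(2) M_props(2) by blast
    fix a assume "a \<in> ?J"
    then obtain y m where a: "y \<in> T" "m \<in> M" "a = y \<otimes> s \<oplus> m" by blast
    have c: "y \<in> carrier K" "m \<in> carrier K" using a M_props(1) T_props(1) by auto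
    { fix r assume r: "r \<in> T"
      then have "r \<in> carrier K" using T_props(1) by auto
      then have "r \<otimes> a = (r \<otimes> y) \<otimes> s \<oplus> r \<otimes> m" unfolding a using c sc by algebra
      then show "r \<otimes> a \<in> ?J" using T_props(6) M_props(5) a r by blast }
    fix b assume "b \<in> ?J"
    then obtain y' m' where b: "y' \<in> T" "m' \<in> M" "b = y' \<otimes> s \<oplus> m'" by blast
    have "y' \<in> carrier K" "m' \<in> carrier K" using b M_props(1) T_props(1) by auto
    then have "a \<oplus> b = (y \<oplus> y') \<otimes> s \<oplus> (m \<oplus> m')" unfolding a b using c sc by algebra
    then show "a \<oplus> b \<in> ?J" using T_props(7) M_props(4) a b by blast
  qed
  moreover have "M \<subseteq> ?J"
  proof
    fix m assume m: "m \<in> M"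
    then have "m = \<zero> \<otimes> s \<oplus> m" using sc M_props(1) T_props(1) by auto
    then show "m \<in> ?J" using m T_props(2) by blast
  qed
  moreover have "s \<in> ?J"
  proof -
    have "s = \<one> \<otimes> s \<oplus> \<zero>" using sc by simp
    then show ?thesis using T_props(3) M_props(2) by blast
  qed
  moreover have "?J \<subseteq> T" using T_props(6,7) s(2) M_props(1) by blast
  moreover have "s \<notin> M" using s(2) by blast
  ultimately have "?J = T"
    using maximalideal.I_maximal[OF M_max, of ?J] by simp blast
  then have "\<one> \<in> ?J" using T_props(3) by simp
  then obtain y m where ym: "y \<in> T" "m \<in> M" "\<one> = y \<otimes> s \<oplus> m" by blast
  have c: "y \<in> carrier K" "m \<in> carrier K" using ym M_props(1) T_props(1) by auto
  have "y \<otimes> s = (y \<otimes> s \<oplus> m) \<oplus> (\<ominus> \<one> \<otimes> m)" using c sc by algebra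
  then have "y \<otimes> s = \<one> \<oplus> (\<ominus> \<one> \<otimes> m)" using ym(3) by simp
  moreover have "\<ominus> \<one> \<otimes> m \<in> R" using M_R R_props(3,5,6) ym by blast
  ultimately have "y \<otimes> s \<in> R" using R_props(3,7) by simp
  moreover have "y \<otimes> s \<notin> M" using M_props(3) M_props(4)[of "y \<otimes> s" m] ym(2,3) by auto
  moreover have "(y \<otimes> s) \<otimes> x = y \<otimes> (s \<otimes> x)" using c sc s(1) by algebra
  ultimately show ?thesis using T_props(6)[OF ym(1) s(3)] by (auto intro!: bexI[of _ "y \<otimes> s"])
qed

lemma localization_R_M_subset: "localization K R M \<subseteq> localization K T M"
proof
  fix x assume "x \<in> localization K R M"
  then show "x \<in> localization K T M"
    unfolding mem_T_M mem_R_M using R_T by blast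
qed

text \<open>If s's = 1 + m, then t = s'(st) - tm. The first term is in \<open>R\<close> by the
  choice of \<open>s\<close>, the second because \<open>M\<close> is an ideal of \<open>T\<close>
  contained in \<open>R\<close>.\<close>

lemma T_Int_localization_R_M: "t \<in> T \<Longrightarrow> t \<in> localization K R M \<Longrightarrow> t \<in> R"
proof -
  assume t: "t \<in> T" "t \<in> localization K R M"
  then obtain s where s: "s \<in> R - M" "s \<otimes> t \<in> R"
    unfolding mem_R_M by blast
  then obtain s' m where s': "s' \<in> R" "m \<in> M" "s' \<otimes> s = \<one> \<oplus> m" using R_inverse by blast
  have c: "s \<in> carrier K" "t \<in> carrier K" "s' \<in> carrier K" "m \<in> carrier K"
    using s s' t M_props(1) T_props(1) R_props(1) by auto
  have "s' \<otimes> (s \<otimes> t) = (s' \<otimes> s) \<otimes> t" using c by algebra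
  then have "t = s' \<otimes> (s \<otimes> t) \<oplus> \<ominus> (t \<otimes> m)" unfolding s'(3) using c by algebra
  moreover have "s' \<otimes> (s \<otimes> t) \<oplus> \<ominus> (t \<otimes> m) \<in> R"
    using R_props(7)[OF R_props(6)[OF s'(1) s(2)] R_props(5)[OF MT_R[OF s'(2) t(1)]]] .
  ultimately show "t \<in> R" by simp
qed

section \<open>Simple overrings of \<open>R\<close>\<close>

lemma R_quotient: "has_quotient_field K R"
proof (rule has_quotient_fieldI[OF R_subring])
  fix x assume x: "x \<in> carrier K"
  then obtain s where s: "s \<in> T" "s \<noteq> \<zero>" "s \<otimes> x \<in> T" using has_quotient_field_mem[OF T_quotient] by blast
  \<comment> \<open>A nonzero \<open>m\<close> in \<open>M\<close> carries both denominator and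
    numerator from \<open>T\<close> into \<open>R\<close>.\<close>
  obtain m where m: "m \<in> M" "m \<noteq> \<zero>" using M_nz M_props(2) by blast
  have c: "s \<in> carrier K" "m \<in> carrier K" using s m M_props(1) T_props(1) by auto
  have "(s \<otimes> m) \<otimes> x = (s \<otimes> x) \<otimes> m" using c x by algebra
  moreover have "s \<otimes> m \<noteq> \<zero>" using c s m integral[of s m] s(1) by auto
  ultimately show "\<exists>r\<in>R - {\<zero>}. r \<otimes> x \<in> R"
    using MT_R[OF m(1) s(1)] MT_R[OF m(1) s(3)] by (auto intro!: bexI[of _ "s \<otimes> m"])
qed

text \<open>If \<open>u\<close> is in T_M, a denominator \<open>s\<close> from \<open>R - M\<close>
  gives su in \<open>T - R\<close>, and minimality applies. If not, both coefficients of a + bu = 1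
  lie in \<open>M\<close>, so t = ta + (tb)u has coefficients in \<open>R\<close> for each
  \<open>t\<close> in \<open>T\<close>.\<close>

lemma T_subset_simple_extension:
  assumes u: "u \<in> carrier K" and nu: "u \<notin> localization K R M"
  shows "T \<subseteq> simple_extension R u"
proof (cases "u \<in> localization K T M")
  case True
  let ?E = "simple_extension R u"
  have E: "subring ?E K" using simple_extension_is_subring[OF R_subring u] .
  have RE: "R \<subseteq> ?E" and uE: "u \<in> ?E"
    using simple_extension_incl[OF R_props(1) u] simple_extension_mem[OF R_subring u] by auto
  obtain s where s: "s \<in> R - M" "s \<otimes> u \<in> T" using mem_localization_T_M[OF True] by blast
  have "s \<otimes> u \<notin> R" using nu s(1) u unfolding mem_R_M by blast
  then show ?thesis using R_minimal[OF E RE, of "s \<otimes> u"] subringE(6)[OF E] RE uE s by blast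
next
  case False
  let ?E = "simple_extension R u"
  have E: "subring ?E K" using simple_extension_is_subring[OF R_subring u] .
  have RE: "R \<subseteq> ?E" and uE: "u \<in> ?E"
    using simple_extension_incl[OF R_props(1) u] simple_extension_mem[OF R_subring u] by auto
  obtain a b where ab: "a \<in> T" "b \<in> T" "a \<otimes> u \<in> T" "b \<otimes> u \<in> T" "a \<oplus> b \<otimes> u = \<one>"
    using pruefer_partition[OF pruefer u] by blast
  have M: "a \<in> M" "b \<in> M" using False ab(1-4) u unfolding mem_T_M by blast+
  show ?thesis
  proof
    fix t assume t: "t \<in> T"
    have c: "a \<in> carrier K" "b \<in> carrier K" "t \<in> carrier K" using t ab T_props(1) by auto
    have "t = t \<otimes> (a \<oplus> b \<otimes> u)" using c ab by simp
    also have "\<dots> = t \<otimes> a \<oplus> (t \<otimes> b) \<otimes> u" using c u by algebra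
    also have "\<dots> \<in> ?E"
      using subringE(7)[OF E _ subringE(6)[OF E _ uE]] MT_R[OF M(1) t] MT_R[OF M(2) t] RE by blast
    finally show "t \<in> ?E" .
  qed
qed

text \<open>Multiplication by \<open>m\<close> moves the coefficients from \<open>T\<close> into
  \<open>R\<close>. This leads from T[u] back to R[u] when \<open>u\<close> is in R_M.\<close>

lemma M_mult_simple_extension:
  assumes u: "u \<in> carrier K" and z: "z \<in> simple_extension T u" and m: "m \<in> M"
  shows "m \<otimes> z \<in> simple_extension R u"
  using z
proof induct
  case zero
  then show ?case using m M_props(1) T_props(1) by (auto simp: subset_iff)
next
  case (lin k t)
  have c: "k \<in> carrier K" "t \<in> carrier K" "m \<in> carrier K"
    using lin m M_props(1) T_props(1) simple_extension_in_carrier[OF T_props(1) u] by auto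
  have "m \<otimes> (k \<otimes> u \<oplus> t) = (m \<otimes> k) \<otimes> u \<oplus> t \<otimes> m" using c u by algebra
  then show ?case using simple_extension.lin[OF lin(2) MT_R[OF m lin(3)]] by simp
qed

lemma sQQR: "sQQR_domain K R"
  unfolding sQQR_domain_def
proof (intro conjI ballI)
  show "has_quotient_field K R" by (rule R_quotient)
  fix u assume u: "u \<in> carrier K"
  let ?E = "simple_extension R u"
  \<comment> \<open>By \<open>localization_restrict\<close> the first family cuts out T[u]; the
    localization at \<open>M\<close>, admissible only if it contains \<open>u\<close>, cuts this
    down to R[u].\<close>
  define S where "S = {P \<inter> R | P. maximalideal P (K\<lparr>carrier := T\<rparr>) \<and> P \<noteq> M \<and> u \<in> localization K T P} \<union>
    (if u \<in> localization K R M then {M} else {})"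
  have E: "subring ?E K" using simple_extension_is_subring[OF R_subring u] .
  have RE: "R \<subseteq> ?E" and uE: "u \<in> ?E"
    using simple_extension_incl[OF R_props(1) u] simple_extension_mem[OF R_subring u] by auto
  have S: "S \<subseteq> prime_spectrum (K\<lparr>carrier := R\<rparr>)"
    using prime_restrict maximal_subring_prime[OF T_subring] M_prime_R
    unfolding S_def prime_spectrum_def by auto
  have le: "?E \<subseteq> localization K R Q" if "Q \<in> S" for Q
  proof -
    have Q: "primeideal Q (K\<lparr>carrier := R\<rparr>)" using S that unfolding prime_spectrum_def by blast
    have "u \<in> localization K R Q"
      using that localization_restrict unfolding S_def by (auto split: if_splits)
    then show ?thesis
      using simple_extension_subring_incl[OF localization_subring[OF R_subring Q] subset_localization[OF R_subring Q]]
      by blast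
  qed
  have ge: "x \<in> ?E" if x: "x \<in> carrier K" and xS: "\<And>Q. Q \<in> S \<Longrightarrow> x \<in> localization K R Q" for x
  proof -
    have other: "x \<in> localization K T P"
      if "maximalideal P (K\<lparr>carrier := T\<rparr>)" "P \<noteq> M" "u \<in> localization K T P" for P
      using xS[of "P \<inter> R"] localization_restrict[OF that(1,2)] that unfolding S_def by blast
    have xT: "x \<in> simple_extension T u"
    proof (rule pruefer_simple_overring_mem[OF pruefer _ u x])
      show "maximalideal P (K\<lparr>carrier := T\<rparr>)" if "primeideal P (K\<lparr>carrier := T\<rparr>)" "P \<noteq> {\<zero>}" for P
        using dim_one_prime_maximal[OF T_subring dim that] .
      \<comment> \<open>For \<open>P = M\<close> nothing is known from \<open>S\<close>; the locale
        assumption deduces this case from the other maximal ideals.\<close>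
      show "x \<in> localization K T P"
        if "maximalideal P (K\<lparr>carrier := T\<rparr>)" "u \<in> localization K T P" for P
        using T_M_if_other_localizations[OF _ x] other that by blast
    qed
    show ?thesis
    proof (cases "u \<in> localization K R M")
      case False
      then have "simple_extension T u \<subseteq> ?E"
        using simple_extension_subring_incl[OF E T_subset_simple_extension[OF u] uE] by blast
      then show ?thesis using xT by blast
    next
      case True
      then have "x \<in> localization K R M" using xS unfolding S_def by simp
      then obtain s where s: "s \<in> R - M" "s \<otimes> x \<in> R"
        unfolding mem_R_M by blast
      then obtain s' m where s': "s' \<in> R" "m \<in> M" "s' \<otimes> s = \<one> \<oplus> m" using R_inverse by blast
      have c: "s \<in> carrier K" "s' \<in> carrier K" "m \<in> carrier K"
        using s s' M_props(1) T_props(1) R_props(1) by auto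
      \<comment> \<open>Since s's = 1 + m, x = s'(sx) - mx with the first term in \<open>R\<close>
        and mx in R[u] by \<open>M_mult_simple_extension\<close>.\<close>
      have "s' \<otimes> (s \<otimes> x) = (s' \<otimes> s) \<otimes> x" using c x by algebra
      then have "x = s' \<otimes> (s \<otimes> x) \<oplus> \<ominus> (m \<otimes> x)" unfolding s'(3) using c x by algebra
      also have "\<dots> \<in> ?E"
        using subringE(5,6,7)[OF E] RE s s' M_mult_simple_extension[OF u xT s'(2)] by blast
      finally show ?thesis .
    qed
  qed
  have "?E = carrier K \<inter> (\<Inter>P\<in>S. localization K R P)"
    using le ge subringE(1)[OF E] by blast
  then show "intersection_of_localizations K R ?E"
    unfolding intersection_of_localizations_def using S by blast
qed

section \<open>The overring T_M of \<open>R\<close>\<close>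

lemma localization_T_M_proper: "localization K T M \<noteq> carrier K"
proof
  assume eq: "localization K T M = carrier K"
  obtain m where m: "m \<in> M" "m \<noteq> \<zero>" using M_nz M_props(2) by blast
  have c: "m \<in> carrier K" using m M_props(1) T_props(1) by auto
  then have mU: "m \<in> Units K" using field_Units m by auto
  then have "inv m \<in> localization K T M" using eq by auto
  \<comment> \<open>A denominator \<open>s\<close> of 1/m equals (s/m)m and would therefore lie in
    \<open>M\<close>.\<close>
  then obtain s where s: "s \<in> T - M" "s \<otimes> inv m \<in> T"
    unfolding mem_T_M by blast
  then have "(s \<otimes> inv m) \<otimes> m \<in> M" using M_props(5) m by blast
  moreover have "(s \<otimes> inv m) \<otimes> m = s" using s(1) T_props(1) mU m_assoc[of s "inv m" m] by auto
  ultimately show False using s by simp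
qed

text \<open>\<open>Q\<close> does not contain \<open>M\<close>, since otherwise \<open>Q = M\<close>
  and \<open>T\<close> would lie in R_M. It then lifts to a prime of \<open>T\<close> that lies
  strictly inside \<open>M\<close>, and dimension one makes the lift zero.\<close>

lemma localization_T_M_le_imp:
  assumes Q: "primeideal Q (K\<lparr>carrier := R\<rparr>)" and le: "localization K T M \<subseteq> localization K R Q"
  shows "Q = {\<zero>}"
proof -
  note Qp = primeideal_subringE[OF R_subring Q] and memQ = mem_localization[OF R_subring Q]
  have "\<not> M \<subseteq> Q"
  proof
    assume "M \<subseteq> Q"
    then have "Q = M" using prime_R_eq_M[OF Q] by blast
    then have "T \<subseteq> localization K R M" using le subset_localization[OF T_subring M_prime] by blast
    then show False using T_Int_localization_R_M R_T by blast
  qed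
  then obtain m where m: "m \<in> M" "m \<notin> Q" by blast
  have mc: "m \<in> carrier K" and mR: "m \<in> R" using m M_R R_props(1) by auto
  \<comment> \<open>The prime of \<open>T\<close> lying over \<open>Q\<close>, described as the
    elements that multiply \<open>M\<close> into \<open>Q\<close>. An \<open>m\<close> in
    \<open>M\<close> outside \<open>Q\<close> shows that it is proper.\<close>
  let ?Q = "{t \<in> T. \<forall>m\<in>M. t \<otimes> m \<in> Q}"
  have Mc: "\<And>m. m \<in> M \<Longrightarrow> m \<in> carrier K" and Tc: "\<And>t. t \<in> T \<Longrightarrow> t \<in> carrier K"
    using M_props(1) T_props(1) by auto
  have "primeideal ?Q (K\<lparr>carrier := T\<rparr>)"
    unfolding primeideal_subring_iff[OF T_subring]
  proof (intro conjI ballI impI)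
    show "?Q \<subseteq> T" by blast
    show "\<zero> \<in> ?Q" using T_props(2) Qp(2) Mc by auto
    show "\<one> \<notin> ?Q" using m l_one[OF mc] by (auto intro!: bexI[of _ m])
    show "a \<oplus> b \<in> ?Q" if "a \<in> ?Q" "b \<in> ?Q" for a b
      using that T_props(7) Qp(4) Mc Tc by (auto simp: l_distr)
    show "x \<otimes> a \<in> ?Q" if "a \<in> ?Q" "x \<in> T" for a x
    proof -
      have "(x \<otimes> a) \<otimes> n \<in> Q" if n: "n \<in> M" for n
      proof -
        have "(x \<otimes> a) \<otimes> n = a \<otimes> (x \<otimes> n)"
          using \<open>a \<in> ?Q\<close> \<open>x \<in> T\<close> Mc[OF n] Tc by (auto simp: m_lcomm m_assoc)
        then show ?thesis using \<open>a \<in> ?Q\<close> M_props(5)[OF n \<open>x \<in> T\<close>] by auto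
      qed
      then show ?thesis using that T_props(6) by blast
    qed
    show "a \<in> ?Q \<or> b \<in> ?Q" if ab: "a \<in> T" "b \<in> T" "a \<otimes> b \<in> ?Q" for a b
    proof (rule ccontr)
      assume "\<not> ?thesis"
      then obtain n n' where n: "n \<in> M" "n' \<in> M" "a \<otimes> n \<notin> Q" "b \<otimes> n' \<notin> Q" using ab by blast
      have "(a \<otimes> n) \<otimes> (b \<otimes> n') = n \<otimes> ((a \<otimes> b) \<otimes> n')"
        using Mc[OF n(1)] Mc[OF n(2)] Tc[OF ab(1)] Tc[OF ab(2)] by algebra
      moreover have "n \<otimes> ((a \<otimes> b) \<otimes> n') \<in> Q" using Qp(5) ab(3) n(1,2) M_R by blast
      ultimately show False using Qp(6) MT_R ab n by metis
    qed
  qed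
  note Q'p = this and Q'e = primeideal_subringE[OF T_subring this]
  \<comment> \<open>For \<open>t\<close> outside \<open>M\<close>, 1/t is in T_M, so some s/t is in
    \<open>R\<close> with \<open>s\<close> outside \<open>Q\<close>. Then sm = (s/t)(tm) would be in
    \<open>Q\<close>, although neither factor is.\<close>
  have "?Q \<subseteq> M"
  proof
    fix t assume t: "t \<in> ?Q"
    show "t \<in> M"
    proof (rule ccontr)
      assume tM: "t \<notin> M"
      then have tU: "t \<in> Units K" using field_Units t Tc M_props(2) by auto
      have "t \<otimes> inv t \<in> T" using tU T_props(3) by simp
      then have "inv t \<in> localization K T M"
        unfolding mem_T_M using t tM tU by blast
      then obtain s where s: "s \<in> R - Q" "s \<otimes> inv t \<in> R" using le mem_localization[OF R_subring Q, of "inv t"] by blast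
      have sc: "s \<in> carrier K" using s R_props(1) by auto
      have "(s \<otimes> inv t) \<otimes> (t \<otimes> m) \<in> Q" using Qp(5) s t m by blast
      moreover have "(s \<otimes> inv t) \<otimes> (t \<otimes> m) = s \<otimes> m \<otimes> (inv t \<otimes> t)"
        using sc tU mc Units_closed[OF tU] Units_inv_closed[OF tU] by algebra
      ultimately have "s \<otimes> m \<in> Q" using tU sc mc by simp
      then show False using Qp(6) s m mR by blast
    qed
  qed
  moreover have "m \<notin> ?Q" using m Qp(6) mR by blast
  ultimately have "?Q \<noteq> M" using m by blast
  have "?Q = {\<zero>}"
  proof (rule ccontr)
    assume "?Q \<noteq> {\<zero>}"
    then have "maximalideal ?Q (K\<lparr>carrier := T\<rparr>)"
      using dim_one_prime_maximal[OF T_subring dim Q'p] by blast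
    then show False
      using maximal_subset_prime_eq[OF T_subring _ M_prime \<open>?Q \<subseteq> M\<close>] \<open>?Q \<noteq> M\<close> by blast
  qed
  moreover have "Q \<subseteq> ?Q"
  proof
    fix q assume q: "q \<in> Q"
    have "q \<otimes> n \<in> Q" if "n \<in> M" for n
      using Qp(5)[OF q, of n] that M_R m_comm[of q n] Mc[OF that] q Qp(1) R_props(1) by (auto simp: subset_iff)
    then show "q \<in> ?Q" using q Qp(1) R_T by blast
  qed
  ultimately show ?thesis using Qp(2) by blast
qed

text \<open>Each localization in such a family contains T_M, so it is the one at the zero ideal. The
  intersection is then the whole field, also for an empty family, but T_M is smaller.\<close>

lemma localization_T_M_not_intersection: "\<not> intersection_of_localizations K R (localization K T M)"
proof
  assume "intersection_of_localizations K R (localization K T M)"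
  then obtain S where S: "S \<subseteq> prime_spectrum (K\<lparr>carrier := R\<rparr>)"
    "localization K T M = carrier K \<inter> (\<Inter>P\<in>S. localization K R P)"
    unfolding intersection_of_localizations_def by blast
  have "carrier K \<subseteq> localization K R Q" if "Q \<in> S" for Q
  proof -
    have Q: "primeideal Q (K\<lparr>carrier := R\<rparr>)" using S(1) that unfolding prime_spectrum_def by blast
    have "localization K T M \<subseteq> localization K R Q" using S(2) that by blast
    then have "Q = {\<zero>}" using localization_T_M_le_imp[OF Q] by blast
    then show ?thesis
      using has_quotient_field_mem[OF R_quotient] unfolding mem_localization[OF R_subring Q] subset_iff by blast
  qed
  then have "localization K T M = carrier K" using S(2) by blast
  then show False using localization_T_M_proper by blast
qed

lemma not_QQR: "\<not> QQR_domain K R"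
proof -
  have "overring K R (localization K T M)"
    unfolding overring_def
    using localization_subring[OF T_subring M_prime] subset_localization[OF T_subring M_prime] R_T by blast
  then show ?thesis unfolding QQR_domain_def using localization_T_M_not_intersection by blast
qed

section \<open>The localization R_M\<close>

abbreviation "RM \<equiv> localization K R M"

lemma RM_subring: "subring RM K" and R_RM: "R \<subseteq> RM"
  using localization_subring[OF R_subring M_prime_R] subset_localization[OF R_subring M_prime_R] by auto

lemma RM_quotient: "has_quotient_field K RM"
  using has_quotient_fieldI[OF RM_subring] has_quotient_field_mem[OF R_quotient] R_RM by blast

lemma RM_unit:
  assumes "s \<in> R - M"
  shows "s \<in> Units K" "inv s \<in> RM"
proof -
  show U: "s \<in> Units K" using assms R_props(1) M_props(2) field_Units by auto
  have "s \<otimes> inv s \<in> R" using U R_props(3) by simp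
  then show "inv s \<in> RM" unfolding mem_R_M using U assms by blast
qed

text \<open>Elements of \<open>R - M\<close> are units of \<open>RM\<close> and so avoid
  \<open>Q\<close>. If \<open>s\<close> and \<open>r\<close> are denominators of \<open>a\<close>
  and ax, then rsa is in \<open>R\<close>, outside \<open>Q\<close>, and a denominator of
  \<open>x\<close>. Thus localizations of \<open>RM\<close> are localizations of
  \<open>R\<close>.\<close>

lemma prime_contract:
  assumes Q: "primeideal Q (K\<lparr>carrier := RM\<rparr>)"
  shows "primeideal (Q \<inter> R) (K\<lparr>carrier := R\<rparr>)"
    and "localization K RM Q = localization K R (Q \<inter> R)"
proof -
  note Qp = primeideal_subringE[OF RM_subring Q]
  show P: "primeideal (Q \<inter> R) (K\<lparr>carrier := R\<rparr>)"
    unfolding primeideal_subring_iff[OF R_subring]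
  proof (intro conjI ballI impI)
    show "Q \<inter> R \<subseteq> R" "\<zero> \<in> Q \<inter> R" "\<one> \<notin> Q \<inter> R" using Qp(2,3) R_props(2) by auto
    show "a \<oplus> b \<in> Q \<inter> R" if "a \<in> Q \<inter> R" "b \<in> Q \<inter> R" for a b using Qp(4) R_props(7) that by auto
    show "x \<otimes> a \<in> Q \<inter> R" if "a \<in> Q \<inter> R" "x \<in> R" for a x using Qp(5) R_props(6) R_RM that by blast
    show "a \<in> Q \<inter> R \<or> b \<in> Q \<inter> R" if "a \<in> R" "b \<in> R" "a \<otimes> b \<in> Q \<inter> R" for a b
      using Qp(6)[of a b] R_RM that by auto
  qed
  note memQ = mem_localization[OF RM_subring Q] and memP = mem_localization[OF R_subring P]
    and memM = mem_R_M
  have unit: "s \<notin> Q" if s: "s \<in> R - M" for s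
  proof
    assume "s \<in> Q"
    then have "inv s \<otimes> s \<in> Q" using Qp(5) RM_unit[OF s] by blast
    then show False using Qp(3) RM_unit[OF s] by simp
  qed
  show "localization K RM Q = localization K R (Q \<inter> R)"
  proof (intro equalityI subsetI)
    fix x assume "x \<in> localization K R (Q \<inter> R)"
    then show "x \<in> localization K RM Q" unfolding memP memQ using R_RM by blast
  next
    fix x assume "x \<in> localization K RM Q"
    then obtain a where a: "x \<in> carrier K" "a \<in> RM" "a \<notin> Q" "a \<otimes> x \<in> RM" unfolding memQ by blast
    obtain s where s: "a \<in> carrier K" "s \<in> R - M" "s \<otimes> a \<in> R" using a(2) unfolding memM by blast
    obtain r where r: "r \<in> R - M" "r \<otimes> (a \<otimes> x) \<in> R" using a(4) unfolding memM by blast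
    have c: "s \<in> carrier K" "r \<in> carrier K" using r s R_props(1) by auto
    have "s \<otimes> a \<notin> Q" using Qp(6) unit[OF s(2)] a(2,3) s(2) R_RM by blast
    then have "r \<otimes> (s \<otimes> a) \<notin> Q" using Qp(6) unit[OF r(1)] r(1) s(3) R_RM by blast
    moreover have "r \<otimes> (s \<otimes> a) \<in> R" using R_props(6) r s by blast
    moreover have "(r \<otimes> (s \<otimes> a)) \<otimes> x = s \<otimes> (r \<otimes> (a \<otimes> x))" using c s(1) a(1) by algebra
    moreover have "s \<otimes> (r \<otimes> (a \<otimes> x)) \<in> R" using R_props(6) r s by blast
    ultimately show "x \<in> localization K R (Q \<inter> R)" unfolding memP
      using a(1) by (auto intro!: bexI[of _ "r \<otimes> (s \<otimes> a)"])
  qed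
qed

text \<open>By minimality the extension contains \<open>T\<close>; it also contains the inverses of
  \<open>R - M\<close>, which suffice to form T_M by \<open>mem_localization_T_M\<close>.\<close>

lemma simple_extension_RM:
  assumes t: "t \<in> T - R"
  shows "simple_extension RM t = localization K T M"
proof
  let ?E = "simple_extension RM t"
  have tc: "t \<in> carrier K" using t T_props(1) by auto
  have E: "subring ?E K" using simple_extension_is_subring[OF RM_subring tc] .
  have RE: "RM \<subseteq> ?E" and tE: "t \<in> ?E"
    using simple_extension_incl[OF subringE(1)[OF RM_subring] tc] simple_extension_mem[OF RM_subring tc] by auto
  show "?E \<subseteq> localization K T M"
    using simple_extension_subring_incl[OF localization_subring[OF T_subring M_prime] localization_R_M_subset, of t]
      subset_localization[OF T_subring M_prime] t by blast
  have TE: "T \<subseteq> ?E" using R_minimal[OF E _ tE t] RE R_RM by blast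
  show "localization K T M \<subseteq> ?E"
  proof
    fix x assume x: "x \<in> localization K T M"
    have xc: "x \<in> carrier K" using x unfolding mem_T_M by blast
    obtain s where s: "s \<in> R - M" "s \<otimes> x \<in> T" using mem_localization_T_M[OF x] by blast
    have "inv s \<otimes> (s \<otimes> x) \<in> ?E" using RM_unit[OF s(1)] RE TE s subringE(6)[OF E] by blast
    moreover have "inv s \<otimes> (s \<otimes> x) = x"
      using RM_unit(1)[OF s(1)] xc m_assoc[of "inv s" s x] by auto
    ultimately show "x \<in> ?E" by simp
  qed
qed

text \<open>T_M is a simple overring of \<open>RM\<close>, and contracting primes would turn a
  representation over \<open>RM\<close> into one over \<open>R\<close>.\<close>

lemma not_sQQR_RM: "\<not> sQQR_domain K RM"
proof
  assume sq: "sQQR_domain K RM"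
  obtain t where t: "t \<in> T - R" using R_T by blast
  then have "t \<in> carrier K" using T_props(1) by auto
  then have "intersection_of_localizations K RM (localization K T M)"
    using sq simple_extension_RM[OF t] unfolding sQQR_domain_def by metis
  then obtain S where S: "S \<subseteq> prime_spectrum (K\<lparr>carrier := RM\<rparr>)"
    "localization K T M = carrier K \<inter> (\<Inter>P\<in>S. localization K RM P)"
    unfolding intersection_of_localizations_def by blast
  have "(\<Inter>P\<in>S. localization K RM P) = (\<Inter>P\<in>(\<lambda>Q. Q \<inter> R) ` S. localization K R P)"
    using S(1) prime_contract(2) unfolding prime_spectrum_def by (auto simp: subset_iff)
  moreover have "(\<lambda>Q. Q \<inter> R) ` S \<subseteq> prime_spectrum (K\<lparr>carrier := R\<rparr>)"
    using S(1) prime_contract(1) unfolding prime_spectrum_def by auto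
  ultimately have "intersection_of_localizations K R (localization K T M)"
    using S(2) unfolding intersection_of_localizations_def by auto
  then show False using localization_T_M_not_intersection by blast
qed

end

section \<open>Passage to the residue field T/M\<close>

lemma canonical_preimage_maximal_subfield:
  fixes K (structure)
  assumes "field K" and T: "subring T K" and M: "maximalideal M (K\<lparr>carrier := T\<rparr>)"
    and F: "subfield F (K\<lparr>carrier := T\<rparr> Quot M)"
    and F_proper: "F \<noteq> carrier (K\<lparr>carrier := T\<rparr> Quot M)"
    and F_maximal: "\<not> (\<exists>L. subfield L (K\<lparr>carrier := T\<rparr> Quot M) \<and>
                          F \<subset> L \<and> L \<subset> carrier (K\<lparr>carrier := T\<rparr> Quot M))"
    and R: "R = canonical_preimage (K\<lparr>carrier := T\<rparr>) M F"
  shows "subring R K" and "M \<subseteq> R" and "R \<subset> T"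
    and "\<And>s. s \<in> R - M \<Longrightarrow> \<exists>s'\<in>R. \<exists>m\<in>M. s' \<otimes> s = \<one> \<oplus> m"
    and "\<And>A t. \<lbrakk>subring A K; R \<subseteq> A; t \<in> A; t \<in> T - R\<rbrakk> \<Longrightarrow> T \<subseteq> A"
proof -
  interpret field K by fact
  let ?B = "K\<lparr>carrier := T\<rparr>"
  interpret B: cring ?B using subring_cring[OF T] .
  interpret Mi: maximalideal M ?B by fact
  interpret Q: field "?B Quot M" using Mi.quotient_is_field[OF B.is_cring] .
  interpret h: ring_hom_ring ?B "?B Quot M" "(+>\<^bsub>?B\<^esub>) M" using Mi.rcos_ring_hom_ring .
  let ?h = "(+>\<^bsub>?B\<^esub>) M"
  note Tc = subringE[OF T] and Fc = subringE[OF subfieldE(1)[OF F]]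
  have MT: "M \<subseteq> T" using Mi.a_subset by simp
  have memR: "a \<in> R \<longleftrightarrow> a \<in> T \<and> ?h a \<in> F" for a unfolding R canonical_preimage_def by simp
  have zero: "\<zero>\<^bsub>?B Quot M\<^esub> = M" by (simp add: FactRing_def)
  have surj: "\<exists>a\<in>T. z = ?h a" if "z \<in> carrier (?B Quot M)" for z
    using that by (auto simp: FactRing_def A_RCOSETS_def')
  have hM: "?h m = M" if "m \<in> M" for m using B.a_rcos_zero[OF Mi.is_ideal that] .
  have eqD: "\<exists>m\<in>M. a = m \<oplus> b" if "?h a = ?h b" "a \<in> T" for a b
  proof -
    have "a \<in> ?h b" using Mi.a_rcos_self[of a] that by simp
    then show ?thesis by (simp add: a_r_coset_def')
  qed
  have "subring R ?B"
  proof (rule B.subringI)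
    show "R \<subseteq> carrier ?B" using memR by auto
    show "\<one>\<^bsub>?B\<^esub> \<in> R" using memR h.hom_one Fc(3) Tc(3) by simp
    show "\<ominus>\<^bsub>?B\<^esub> a \<in> R" if "a \<in> R" for a
      using that memR[of a] memR[of "\<ominus>\<^bsub>?B\<^esub> a"] h.hom_a_inv[of a] B.a_inv_closed[of a] Fc(5) by simp
    show "a \<otimes>\<^bsub>?B\<^esub> b \<in> R" if "a \<in> R" "b \<in> R" for a b
      using that memR[of a] memR[of b] memR[of "a \<otimes>\<^bsub>?B\<^esub> b"] h.hom_mult[of a b] Tc(6)[of a b] Fc(6) by simp
    show "a \<oplus>\<^bsub>?B\<^esub> b \<in> R" if "a \<in> R" "b \<in> R" for a b
      using that memR[of a] memR[of b] memR[of "a \<oplus>\<^bsub>?B\<^esub> b"] h.hom_add[of a b] Tc(7)[of a b] Fc(7) by simp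
  qed
  then have "ring (K\<lparr>carrier := R\<rparr>)" using B.subring_is_ring by simp
  moreover have RT: "R \<subseteq> T" using memR by blast
  ultimately show "subring R K" using subring_iff[of R] Tc(1) by blast
  show "M \<subseteq> R" using memR hM MT Fc(2) zero by auto
  obtain z where z: "z \<in> carrier (?B Quot M)" "z \<notin> F" using F_proper Fc(1) by blast
  then show "R \<subset> T" using surj[OF z(1)] memR RT by blast
  show "\<exists>s'\<in>R. \<exists>m\<in>M. s' \<otimes> s = \<one> \<oplus> m" if s: "s \<in> R - M" for s
  proof -
    have sT: "s \<in> T" and hs: "?h s \<in> F" using s memR by auto
    have "?h s \<noteq> M" using Mi.a_rcos_self[of s] s sT by auto
    then have hs': "?h s \<in> F - {\<zero>\<^bsub>?B Quot M\<^esub>}" using hs zero by simp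
    have iF: "inv\<^bsub>?B Quot M\<^esub> (?h s) \<in> F" and il: "inv\<^bsub>?B Quot M\<^esub> (?h s) \<otimes>\<^bsub>?B Quot M\<^esub> ?h s = \<one>\<^bsub>?B Quot M\<^esub>"
      using Q.subfield_m_inv[OF F hs'] by auto
    \<comment> \<open>\<open>s'\<close> lifts the inverse of the residue of \<open>s\<close>, which
      lies in \<open>F\<close>. Hence s's and 1 have the same coset.\<close>
    obtain s' where s': "s' \<in> T" "inv\<^bsub>?B Quot M\<^esub> (?h s) = ?h s'" using surj iF Fc(1) by blast
    have "?h (s' \<otimes> s) = ?h \<one>"
      using il h.hom_mult[of s' s] h.hom_one s' sT by simp
    then obtain m where "m \<in> M" "s' \<otimes> s = m \<oplus> \<one>" using eqD Tc(6)[OF s'(1) sT] by blast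
    moreover have "s' \<in> R" using memR s' iF by simp
    moreover have "m \<oplus> \<one> = \<one> \<oplus> m" using a_comm[of m \<one>] \<open>m \<in> M\<close> MT Tc(1) by auto
    ultimately show ?thesis by metis
  qed
  show "T \<subseteq> A" if A: "subring A K" "R \<subseteq> A" "t \<in> A" "t \<in> T - R" for A t
  proof
    have tT: "t \<in> T" using A by simp
    have "?h t \<in> carrier (?B Quot M) - F" using A(4) memR[of t] h.hom_closed[of t] by auto
    \<comment> \<open>The residue of \<open>t\<close> generates T/M as a ring over
      \<open>F\<close>.\<close>
    then have ext: "Q.simple_extension F (?h t) = carrier (?B Quot M)"
    proof (rule Q.maximal_subfield_simple_extension[OF F])
      show "L = carrier (?B Quot M)" if "subfield L (?B Quot M)" "F \<subset> L" for L
        using F_maximal that subfieldE(3)[OF that(1)] by blast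
    qed
    \<comment> \<open>Coefficients in \<open>F\<close> lift to \<open>R\<close>, hence to
      \<open>A\<close>, so Horner's scheme can be carried out on representatives in
      \<open>A\<close>.\<close>
    have rep: "\<exists>a\<in>A \<inter> T. z = ?h a" if "z \<in> Q.simple_extension F (?h t)" for z
      using that
    proof induct
      case zero
      have "\<zero> \<in> A \<inter> T" using subringE(2)[OF A(1)] Tc(2) by auto
      moreover have "\<zero>\<^bsub>?B Quot M\<^esub> = ?h \<zero>" using h.hom_zero by simp
      ultimately show ?case by blast
    next
      case (lin k c)
      then obtain a where a: "a \<in> A" "a \<in> T" "k = ?h a" by blast
      obtain r where r: "r \<in> T" "c = ?h r" using surj lin(3) Fc(1) by blast
      then have "r \<in> A" using memR lin(3) A(2) by blast
      then have "a \<otimes> t \<oplus> r \<in> A \<inter> T"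
        using subringE(6,7)[OF A(1)] Tc(6,7) a A(3) tT r(1) by blast
      moreover have "?h (a \<otimes> t \<oplus> r) = k \<otimes>\<^bsub>?B Quot M\<^esub> ?h t \<oplus>\<^bsub>?B Quot M\<^esub> c"
        using h.hom_add[of "a \<otimes> t" r] h.hom_mult[of a t] a r tT Tc(6)[OF a(2) tT] by simp
      ultimately show ?case by metis
    qed
    fix y assume y: "y \<in> T"
    then have "?h y \<in> Q.simple_extension F (?h t)" using ext h.hom_closed[of y] by simp
    then obtain a where a: "a \<in> A" "?h y = ?h a" using rep by blast
    \<comment> \<open>\<open>y\<close> and its representative \<open>a\<close> differ by an element
      of \<open>M\<close>, which \<open>A\<close> contains through \<open>R\<close>.\<close>
    then obtain m where "m \<in> M" "y = m \<oplus> a" using eqD y by blast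
    then show "y \<in> A" using subringE(7)[OF A(1)] a(1) \<open>M \<subseteq> R\<close> A(2) by blast
  qed
qed

theorem proposition3p3:
  fixes K :: "('a, 'b) ring_scheme"
    and T M R :: "'a set"
    and \<P> :: "'a set set"
    and F :: "'a set set"
  assumes pruefer: "pruefer_domain K T"
    and dim: "has_krull_dim (K\<lparr>carrier := T\<rparr>) 1"
    and Max: "max_spectrum (K\<lparr>carrier := T\<rparr>) = {M} \<union> \<P>"
    and inf: "infinite \<P>"
    and almost_all: "\<forall>a \<in> M. finite {P \<in> \<P>. a \<notin> P}"
    and inf_many: "\<forall>a \<in> T - M. infinite {P \<in> \<P>. a \<notin> P}"
    and F: "subfield F (K\<lparr>carrier := T\<rparr> Quot M)"
    and F_proper: "F \<noteq> carrier (K\<lparr>carrier := T\<rparr> Quot M)"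
    and F_maximal: "\<not> (\<exists>L. subfield L (K\<lparr>carrier := T\<rparr> Quot M) \<and>
                          F \<subset> L \<and> L \<subset> carrier (K\<lparr>carrier := T\<rparr> Quot M))"
    and R: "R = canonical_preimage (K\<lparr>carrier := T\<rparr>) M F"
  shows "sQQR_domain K R \<and> \<not> QQR_domain K R \<and>
         has_quotient_field K (localization K R M) \<and>
         \<not> sQQR_domain K (localization K R M)"
proof -
  have K: "field K" and T: "subring T K"
    using pruefer unfolding pruefer_domain_def has_quotient_field_def by auto
  interpret field K by (rule K)
  have max: "maximalideal P (K\<lparr>carrier := T\<rparr>) \<longleftrightarrow> P = M \<or> P \<in> \<P>" for P
    using Max unfolding max_spectrum_def by auto
  then have M: "maximalideal M (K\<lparr>carrier := T\<rparr>)" by simp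
  note preimage = canonical_preimage_maximal_subfield[OF K T M F F_proper F_maximal R]
  interpret minimal_pullback K T M R
  proof (intro minimal_pullback.intro minimal_pullback_axioms.intro K)
    \<comment> \<open>If \<open>M\<close> were zero, every other maximal ideal would contain it and
      thus equal it, but \<open>\<P>\<close> is infinite.\<close>
    show "M \<noteq> {\<zero>\<^bsub>K\<^esub>}"
    proof
      assume M0: "M = {\<zero>\<^bsub>K\<^esub>}"
      have "infinite (\<P> - {M})" using inf by simp
      then obtain P where P: "P \<in> \<P>" "P \<noteq> M" using infinite_imp_nonempty by blast
      then have "primeideal P (K\<lparr>carrier := T\<rparr>)" using maximal_subring_prime[OF T] max by blast
      then show False
        using maximal_subset_prime_eq[OF T M] primeideal_subringE(2)[OF T] P(2) M0 by blast
    qed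
    show "x \<in> localization K T M"
      if "u \<in> localization K T M" "x \<in> carrier K"
        "\<And>P. \<lbrakk>maximalideal P (K\<lparr>carrier := T\<rparr>); P \<noteq> M; u \<in> localization K T P\<rbrakk> \<Longrightarrow> x \<in> localization K T P"
      for u x
      using pruefer_mem_localization[OF pruefer M _ _ _ that(1,2), of \<P>] that(3) max almost_all inf_many
      by blast
  qed (fact pruefer dim M preimage)+
  show ?thesis using sQQR not_QQR RM_quotient not_sQQR_RM by blast
qed

end
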